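(* Let $\mathbb{K}$ be a field of characteristic $0$. For a positive integer $r$, let $\mu(r)$ be the least integer $h$ such that $(1,r,h,r,1)$ is the Hilbert function of a standard graded Artinian Gorenstein $\mathbb{K}$-algebra, and let $\delta(r)=r-\mu(r)$. Then $\delta(24)=4$ and $\delta(40)=10$.
   Context: Standard graded Artinian Gorenstein algebras $Q/I$ are taken with $I$ containing no linear forms, so the codimension equals $h_1$. *)

theory Defs
  imports Main "HOL-Library.Poly_Mapping"
begin

text \<open>Polynomials over a field 'k: finitely supported maps from monomials
(exponent vectors, finitely supported nat-valued maps) to coefficients, with convolution product.
The polynomial ring Q = K[x_0,...,x_{r-1}] is the set of polynomials involving
only the variables x_j with j < r.\<close>

type_synonym 'k mpoly = "(nat \<Rightarrow>\<^sub>0 nat) \<Rightarrow>\<^sub>0 'k"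

definition var :: "nat \<Rightarrow> 'k::field mpoly" where
  "var j = Poly_Mapping.single (Poly_Mapping.single j 1) 1"

definition smult_mp :: "'k::field \<Rightarrow> 'k mpoly \<Rightarrow> 'k mpoly" where
  "smult_mp c p = Poly_Mapping.single 0 c * p"

definition mdeg :: "(nat \<Rightarrow>\<^sub>0 nat) \<Rightarrow> nat" where
  "mdeg m = (\<Sum>j\<in>Poly_Mapping.keys m. Poly_Mapping.lookup m j)"

definition polyring :: "nat \<Rightarrow> 'k::field mpoly set" where
  "polyring r = {p. \<forall>m\<in>Poly_Mapping.keys p. \<forall>j\<in>Poly_Mapping.keys m. j < r}"

definition forms :: "nat \<Rightarrow> nat \<Rightarrow> 'k::field mpoly set" where
  "forms r d = {p \<in> polyring r. \<forall>m\<in>Poly_Mapping.keys p. mdeg m = d}"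

definition hcomp :: "nat \<Rightarrow> 'k::field mpoly \<Rightarrow> 'k mpoly" where
  "hcomp d p = Abs_poly_mapping (\<lambda>m. if mdeg m = d then Poly_Mapping.lookup p m else 0)"

definition is_ideal :: "nat \<Rightarrow> 'k::field mpoly set \<Rightarrow> bool" where
  "is_ideal r I \<longleftrightarrow> I \<subseteq> polyring r \<and> 0 \<in> I \<and>
     (\<forall>p\<in>I. \<forall>q\<in>I. p + q \<in> I) \<and> (\<forall>p\<in>I. \<forall>q\<in>polyring r. q * p \<in> I)"

definition homogeneous_ideal :: "nat \<Rightarrow> 'k::field mpoly set \<Rightarrow> bool" where
  "homogeneous_ideal r I \<longleftrightarrow> is_ideal r I \<and> (\<forall>p\<in>I. \<forall>d. hcomp d p \<in> I)"

text \<open>Dimension over K of the image of the set V in the quotient Q/W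
(the maximal number of elements of V that are K-linearly independent modulo W).\<close>
definition qdim :: "'k::field mpoly set \<Rightarrow> 'k mpoly set \<Rightarrow> nat" where
  "qdim V W = Sup {n. \<exists>f::nat \<Rightarrow> 'k mpoly. (\<forall>i<n. f i \<in> V) \<and>
      (\<forall>c::nat \<Rightarrow> 'k. (\<Sum>i<n. smult_mp (c i) (f i)) \<in> W \<longrightarrow> (\<forall>i<n. c i = 0))}"

definition hilb :: "nat \<Rightarrow> 'k::field mpoly set \<Rightarrow> nat \<Rightarrow> nat" where
  "hilb r I d = qdim (forms r d) I"

definition artinian :: "nat \<Rightarrow> 'k::field mpoly set \<Rightarrow> bool" where
  "artinian r I \<longleftrightarrow> (\<exists>N. \<forall>d\<ge>N. forms r d \<subseteq> I)"

text \<open>Degree-d part of the socle (0 :_A m) of A = Q/I, m = (x_0,...,x_{r-1});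
for homogeneous I the socle is a graded submodule, so its dimension is the sum
of the dimensions of its graded pieces.\<close>
definition socle_deg :: "nat \<Rightarrow> 'k::field mpoly set \<Rightarrow> nat \<Rightarrow> nat" where
  "socle_deg r I d = qdim {f \<in> forms r d. \<forall>j<r. var j * f \<in> I} I"

definition socle_dim :: "nat \<Rightarrow> 'k::field mpoly set \<Rightarrow> nat" where
  "socle_dim r I = (\<Sum>d\<in>{d. socle_deg r I d \<noteq> 0}. socle_deg r I d)"

definition std_graded_AG :: "nat \<Rightarrow> 'k::field mpoly set \<Rightarrow> bool" where
  "std_graded_AG r I \<longleftrightarrow> homogeneous_ideal r I \<and> 1 \<notin> I \<and>
     I \<inter> forms r 1 = {0} \<and> artinian r I \<and> socle_dim r I = 1"

text \<open>(1,r,h,r,1) is the Hilbert function of a standard graded AG K-algebra.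
Since I has no linear forms, the number of variables equals h_1 = r.\<close>
definition is_AG_hf_1rhr1 :: "'k::field itself \<Rightarrow> nat \<Rightarrow> nat \<Rightarrow> bool" where
  "is_AG_hf_1rhr1 _ r h \<longleftrightarrow> (\<exists>I :: 'k mpoly set. std_graded_AG r I \<and>
     hilb r I 0 = 1 \<and> hilb r I 1 = r \<and> hilb r I 2 = h \<and> hilb r I 3 = r \<and>
     hilb r I 4 = 1 \<and> (\<forall>d\<ge>5. hilb r I d = 0))"

definition mu :: "'k::field itself \<Rightarrow> nat \<Rightarrow> nat" where
  "mu K r = (LEAST h. is_AG_hf_1rhr1 K r h)"

definition delta :: "'k::field itself \<Rightarrow> nat \<Rightarrow> int" where
  "delta K r = int r - int (mu K r)"

end

theory Submission
  imports Defs "HOL-Library.Function_Algebras" "HOL-Computational_Algebra.Polynomial"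
begin

text \<open>By Macaulay duality the algebra is the annihilator of a quartic \<open>\<phi>\<close>, and the degree one and two
  parts of the algebra are the spaces of first and second derivatives (contractions) of \<open>\<phi>\<close>.
  For the lower bound on \<open>h\<close>, let \<open>x\<close> be a general linear form, \<open>G\<close> the space of cubics among the first
  derivatives of \<open>\<phi>\<close> killed by \<open>x\<close>, and \<open>K\<close> the space of quadrics among the second derivatives killed
  by \<open>x\<close>; by symmetry \<open>dim K \<le> dim G - (r - h)\<close>, while all derivatives of \<open>G\<close> lie in \<open>K\<close>. A Macaulay type
  bound then forces \<open>G\<close> to be large when \<open>r - h\<close> is large, and Green's hyperplane restriction theorem
  forces \<open>G\<close> to be small. Both bounds follow from one estimate: if all contractions by linear
  forms have rank at most \<open>\<rho>\<close> on a space of quadrics, its dimension is at most \<open>\<rho>(\<rho> + 1)/2\<close>.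
  This is proved by perturbing a linear form of maximal rank; cubics are reduced to quadrics by
  restricting to the kernel of a general linear form. The bound is attained by the trivial extension
  \<open>\<Sum> M y\<^sub>M\<close> over all cubic monomials \<open>M\<close> in 4, respectively 5, variables.\<close>

section \<open>Finite-dimensional spaces of functions\<close>

text \<open>The values 24 and 40 are \<open>n + tet n\<close> for \<open>n = 4, 5\<close>, where the
  trivial extension has middle entry at most \<open>2 * tri n\<close>, that is 20 and 30. The lower
  bound must therefore exclude \<open>r - h \<ge> 5\<close>, which is \<open>tet 2 + 1\<close>, and
  \<open>r - h \<ge> 11\<close>, which is \<open>tet 3 + 1\<close>. The kernel estimate holds for
  every linear form, so it caps all ranks on the space of first derivatives at once, at 24 - 13 = 11
  and at 40 - 23 = 17. These caps are not triangular numbers, and rounding them up to 15 and 21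
  would allow dimensions 35 and 56. Hence the bound for cubics is refined at exactly 11 and 17,
  where it gives 21 < 24 and 38 < 40. The recurring obstacle is that several maximal rank conditions
  must hold for the same linear form. Each condition fails for only finitely many points of a line
  through a point where it holds, and characteristic 0 provides infinitely many points.\<close>

definition fscale :: "'k::field \<Rightarrow> ('a \<Rightarrow> 'k) \<Rightarrow> 'a \<Rightarrow> 'k" where
  "fscale c f = (\<lambda>x. c * f x)"

lemma fscale_apply [simp]: "fscale c f x = c * f x"
  by (simp add: fscale_def)

interpretation fs: vector_space fscale
  by unfold_locales (auto simp: fun_eq_iff algebra_simps)

interpretation fsp: vector_space_pair fscale fscale ..

lemma sum_fun_apply: "(\<Sum>i\<in>I. f i) x = (\<Sum>i\<in>I. f i x)" for f :: "'i \<Rightarrow> 'a \<Rightarrow> 'b::comm_monoid_add"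
  by (induction I rule: infinite_finite_induct) auto

lemma fs_linearI:
  assumes "\<And>f g. T (f + g) = T f + T g" "\<And>c f. T (fscale c f) = fscale c (T f)"
  shows "Vector_Spaces.linear fscale fscale T"
  unfolding Vector_Spaces.linear_iff by (intro conjI allI assms fs.vector_space_axioms)

text \<open>The ambient function spaces can be infinite-dimensional, and \<open>fs.dim\<close> is 0
  on a set without a finite basis, so monotonicity of \<open>fs.dim\<close> needs this
  guard.\<close>

definition fin_dim :: "('a \<Rightarrow> 'k::field) set \<Rightarrow> bool" where
  "fin_dim V \<longleftrightarrow> (\<exists>B. finite B \<and> V \<subseteq> fs.span B)"

lemma fin_dim_subset: "fin_dim W \<Longrightarrow> V \<subseteq> W \<Longrightarrow> fin_dim V"
  unfolding fin_dim_def by blast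

lemma finite_independent_fin_dim: "fin_dim V \<Longrightarrow> fs.independent A \<Longrightarrow> A \<subseteq> V \<Longrightarrow> finite A"
  unfolding fin_dim_def using fs.independent_span_bound by blast

lemma fin_dim_basis:
  assumes "fin_dim V"
  obtains B where "finite B" "B \<subseteq> V" "fs.independent B" "V \<subseteq> fs.span B" "card B = fs.dim V"
  using fs.basis_exists[of V] finite_independent_fin_dim[OF assms] by metis

lemma card_le_dim_fin_dim:
  assumes "fin_dim V" "A \<subseteq> V" "fs.independent A"
  shows "card A \<le> fs.dim V"
proof -
  obtain B where "finite B" "V \<subseteq> fs.span B" "card B = fs.dim V"
    using fin_dim_basis[OF assms(1)] by metis
  then show ?thesis
    using fs.independent_span_bound[of B A] assms by auto
qed

lemma dim_mono_fin_dim: "fin_dim W \<Longrightarrow> V \<subseteq> W \<Longrightarrow> fs.dim V \<le> fs.dim W"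
  by (metis card_le_dim_fin_dim fs.basis_exists order_trans)

lemma dim_eq_0_fin_dim:
  assumes "fin_dim V" "fs.dim V = 0"
  shows "V \<subseteq> {0}"
  using fin_dim_basis[OF assms(1)] assms(2) by (metis card_0_eq fs.span_empty)

lemma indep_family_image:
  assumes "finite I" and "\<And>c. (\<Sum>i\<in>I. fscale (c i) (v i)) = 0 \<Longrightarrow> \<forall>i\<in>I. c i = 0"
  shows "inj_on v I" "fs.independent (v ` I)"
proof -
  show inj: "inj_on v I"
  proof (rule inj_onI, rule ccontr)
    fix x y assume xy: "x \<in> I" "y \<in> I" "v x = v y" "x \<noteq> y"
    let ?c = "\<lambda>i. if i = x then 1 else if i = y then - 1 else 0"
    have "(\<Sum>i\<in>I. fscale (?c i) (v i)) = (\<Sum>i\<in>{x, y}. fscale (?c i) (v i))"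
      using xy assms(1) by (intro sum.mono_neutral_right) auto
    also have "\<dots> = 0" using xy by simp
    finally show False using assms(2)[of ?c] xy by auto
  qed
  show "fs.independent (v ` I)"
  proof (rule fs.independent_if_scalars_zero)
    show "finite (v ` I)" using assms(1) by simp
    fix f x assume f: "(\<Sum>x\<in>v ` I. fscale (f x) x) = 0" and x: "x \<in> v ` I"
    have "(\<Sum>i\<in>I. fscale (f (v i)) (v i)) = 0"
      using f by (simp add: sum.reindex[OF inj])
    from assms(2)[OF this] x show "f x = 0" by auto
  qed
qed

lemma fin_dim_image:
  assumes "Vector_Spaces.linear fscale fscale f" "fin_dim V"
  shows "fin_dim (f ` V)"
proof -
  obtain B where B: "finite B" "V \<subseteq> fs.span B"
    using assms(2) unfolding fin_dim_def by blast
  have "f ` V \<subseteq> fs.span (f ` B)"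
    using B(2) fsp.linear_span_image[OF assms(1), of B] by blast
  then show ?thesis unfolding fin_dim_def using B(1) by blast
qed

text \<open>A basis \<open>A\<close> of the kernel and chosen preimages \<open>g b\<close> of a
  basis \<open>B\<close> of the image together form a basis of \<open>V\<close>.\<close>

lemma rank_nullity:
  assumes f: "Vector_Spaces.linear fscale fscale f" and V: "fs.subspace V" "fin_dim V"
  shows "fs.dim V = fs.dim (f ` V) + fs.dim {v \<in> V. f v = 0}"
proof -
  let ?N = "{v \<in> V. f v = 0}"
  have N: "fs.subspace ?N"
    using V(1) fsp.linear_0[OF f] fsp.linear_add[OF f] fsp.linear_scale[OF f]
    unfolding fs.subspace_def by auto
  have Nf: "fin_dim ?N" using fin_dim_subset[OF V(2)] by auto
  obtain A where A: "finite A" "A \<subseteq> ?N" "fs.independent A" "?N \<subseteq> fs.span A"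
      "card A = fs.dim ?N"
    by (rule fin_dim_basis[OF Nf])
  obtain B where B: "finite B" "B \<subseteq> f ` V" "fs.independent B" "f ` V \<subseteq> fs.span B"
      "card B = fs.dim (f ` V)"
    by (rule fin_dim_basis[OF fin_dim_image[OF f V(2)]])
  have "\<forall>b\<in>B. \<exists>v\<in>V. f v = b" using B(2) by auto
  then obtain g where g: "\<And>b. b \<in> B \<Longrightarrow> g b \<in> V" "\<And>b. b \<in> B \<Longrightarrow> f (g b) = b" by metis
  have inj: "inj_on g B" by (metis g(2) inj_onI)
  have fgB: "f ` g ` B = B" using g(2) by (force simp: image_iff)
  have injf: "inj_on f (g ` B)" using g(2) by (auto simp: inj_on_def)
  have indg: "fs.independent (g ` B)"
  proof (rule indep_family_image(2)[OF B(1)])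
    fix c assume "(\<Sum>i\<in>B. fscale (c i) (g i)) = 0"
    then have "f (\<Sum>i\<in>B. fscale (c i) (g i)) = 0" using fsp.linear_0[OF f] by simp
    then have "(\<Sum>i\<in>B. fscale (c i) i) = 0"
      using g(2) by (simp add: fsp.linear_sum[OF f] fsp.linear_scale[OF f])
    then show "\<forall>i\<in>B. c i = 0"
      using fs.independentD[OF B(3) B(1) order_refl] by blast
  qed
  have fA: "f x = 0" if "x \<in> fs.span A" for x
    using A(2) fsp.linear_eq_0_on_span[OF f _ that] by blast
  have disj: "A \<inter> g ` B = {}"
  proof (rule ccontr)
    assume "A \<inter> g ` B \<noteq> {}"
    then obtain b where b: "b \<in> B" "g b \<in> A" by auto
    then have "b = 0" using A(2) g(2)[of b] by auto
    then show False using b B(3) fs.dependent_zero by blast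
  qed
  have ind: "fs.independent (A \<union> g ` B)"
  proof (rule fs.independent_if_scalars_zero)
    show "finite (A \<union> g ` B)" using A(1) B(1) by simp
    fix c x assume s: "(\<Sum>x\<in>A \<union> g ` B. fscale (c x) x) = 0" and x: "x \<in> A \<union> g ` B"
    have s2: "(\<Sum>x\<in>A. fscale (c x) x) + (\<Sum>x\<in>g ` B. fscale (c x) x) = 0"
      using s sum.union_disjoint[OF A(1) _ disj, of "\<lambda>x. fscale (c x) x"] B(1) by auto
    have "f (\<Sum>x\<in>A. fscale (c x) x) = 0"
      by (rule fA) (intro fs.span_sum fs.span_scale fs.span_base)
    then have "f (\<Sum>x\<in>g ` B. fscale (c x) x) = 0"
      using arg_cong[OF s2, of f] by (simp add: fsp.linear_add[OF f] fsp.linear_0[OF f])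
    moreover have "(\<Sum>x\<in>g ` B. fscale (c x) x) \<in> fs.span (g ` B)"
      by (intro fs.span_sum fs.span_scale fs.span_base)
    ultimately have z: "(\<Sum>x\<in>g ` B. fscale (c x) x) = 0"
      using fsp.linear_indep_image_lemma[OF f _ _ injf] B(1,3) fgB by simp
    then have z2: "(\<Sum>x\<in>A. fscale (c x) x) = 0" using s2 by simp
    show "c x = 0"
      using x fs.independentD[OF A(3) A(1) order_refl z2]
        fs.independentD[OF indg _ order_refl z] B(1) by blast
  qed
  have span: "V \<subseteq> fs.span (A \<union> g ` B)"
  proof
    fix v assume v: "v \<in> V"
    then have "f v \<in> fs.span (f ` g ` B)" using B(4) fgB by auto
    then obtain w where w: "w \<in> fs.span (g ` B)" "f v = f w"
      using fsp.linear_span_image[OF f] by auto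
    have "w \<in> V" using fs.span_minimal[OF _ V(1), of "g ` B"] g(1) w(1) by blast
    then have "v - w \<in> ?N" using v w(2) V(1) by (simp add: fs.subspace_diff fsp.linear_diff[OF f])
    then have "v - w \<in> fs.span (A \<union> g ` B)"
      using A(4) fs.span_mono[of A "A \<union> g ` B"] by blast
    moreover have "w \<in> fs.span (A \<union> g ` B)"
      using w(1) fs.span_mono[of "g ` B" "A \<union> g ` B"] by blast
    ultimately show "v \<in> fs.span (A \<union> g ` B)"
      using fs.span_add by fastforce
  qed
  have "fs.dim V = card (A \<union> g ` B)"
    by (rule fs.dim_unique[OF _ span ind refl]) (use A(2) g(1) in auto)
  also have "\<dots> = card A + card B"
    using card_Un_disjoint[OF A(1) _ disj] B(1) card_image[OF inj] by simp
  finally show ?thesis using A(5) B(5) by simp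
qed

lemma fin_dim_finite_support:
  assumes "finite S"
  shows "fin_dim {f :: 'a \<Rightarrow> 'k::field. \<forall>x. x \<notin> S \<longrightarrow> f x = 0}"
    and "fs.dim {f :: 'a \<Rightarrow> 'k::field. \<forall>x. x \<notin> S \<longrightarrow> f x = 0} = card S"
proof -
  let ?V = "{f :: 'a \<Rightarrow> 'k. \<forall>x. x \<notin> S \<longrightarrow> f x = 0}"
  let ?u = "\<lambda>s x. if x = s then 1 else 0 :: 'k"
  have *: "(\<Sum>s\<in>S. fscale (c s) (?u s)) = (\<lambda>x. if x \<in> S then c x else 0)" for c
    using assms by (auto simp: fun_eq_iff sum_fun_apply if_distrib cong: if_cong)
  have sp: "?V \<subseteq> fs.span (?u ` S)"
  proof
    fix f assume "f \<in> ?V"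
    then have "f = (\<Sum>s\<in>S. fscale (f s) (?u s))" unfolding * by (auto simp: fun_eq_iff)
    also have "\<dots> \<in> fs.span (?u ` S)"
      by (intro fs.span_sum fs.span_scale fs.span_base imageI)
    finally show "f \<in> fs.span (?u ` S)" .
  qed
  have ind: "c s = 0" if "(\<Sum>s\<in>S. fscale (c s) (?u s)) = 0" "s \<in> S" for c s
    using fun_cong[OF that(1)[unfolded *], of s] that(2) by simp
  show "fin_dim ?V" unfolding fin_dim_def using sp assms by blast
  have inj: "inj_on ?u S" "fs.independent (?u ` S)"
    using indep_family_image[OF assms, of ?u] ind by blast+
  show "fs.dim ?V = card S"
    by (rule fs.dim_unique[OF _ sp inj(2) card_image[OF inj(1)]]) auto
qed

lemma dim_le_separating_coordinates:
  fixes V :: "('a \<Rightarrow> 'k::field) set"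
  assumes V: "fs.subspace V" "fin_dim V" and S: "finite S"
    and sep: "\<And>f. f \<in> V \<Longrightarrow> \<forall>x\<in>S. f x = 0 \<Longrightarrow> f = 0"
  shows "fs.dim V \<le> card S"
proof -
  let ?R = "\<lambda>f x. if x \<in> S then f x else 0 :: 'k"
  have "Vector_Spaces.linear fscale fscale ?R"
    by (rule fs_linearI) (auto simp: fun_eq_iff)
  from rank_nullity[OF this V]
  have "fs.dim V = fs.dim (?R ` V) + fs.dim {f \<in> V. ?R f = 0}" .
  moreover have "{f \<in> V. ?R f = 0} \<subseteq> {0}"
    using sep by (auto simp: fun_eq_iff)
  then have "fs.dim {f \<in> V. ?R f = 0} \<le> card ({} :: ('a \<Rightarrow> 'k) set)"
    by (intro fs.dim_le_card) auto
  moreover have "fs.dim (?R ` V) \<le> card S"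
    unfolding fin_dim_finite_support(2)[OF S, where 'k = 'k, symmetric]
    by (rule dim_mono_fin_dim[OF fin_dim_finite_support(1)[OF S]]) auto
  ultimately show ?thesis by simp
qed

text \<open>Pivots of an echelon basis, found one at a time: evaluation at a coordinate where some
  element is nonzero has a kernel of smaller dimension.\<close>

lemma ex_separating_coordinates:
  fixes V :: "('a \<Rightarrow> 'k::field) set"
  assumes "fs.subspace V" "fin_dim V"
  shows "\<exists>S. finite S \<and> card S \<le> fs.dim V \<and> (\<forall>f\<in>V. (\<forall>x\<in>S. f x = 0) \<longrightarrow> f = 0)"
  using assms
proof (induction "fs.dim V" arbitrary: V rule: less_induct)
  case less
  show ?case
  proof (cases "V \<subseteq> {0}")
    case True
    then show ?thesis by (intro exI[of _ "{}"]) auto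
  next
    case False
    then obtain g where "g \<in> V" "g \<noteq> 0" by auto
    then obtain x where g: "g \<in> V" "g x \<noteq> 0" by (auto simp: fun_eq_iff)
    \<comment> \<open>Scalars are coded as functions on \<open>unit\<close>, so that
      \<open>rank_nullity\<close> applies to evaluation at \<open>x\<close>.\<close>
    let ?T = "\<lambda>f (u::unit). f x"
    let ?N = "{f \<in> V. ?T f = 0}"
    have lin: "Vector_Spaces.linear fscale fscale ?T"
      by (rule fs_linearI) (auto simp: fun_eq_iff)
    have fd: "fin_dim (?T ` V)" by (rule fin_dim_image[OF lin less.prems(2)])
    have "?T g \<noteq> 0" using g by (auto simp: fun_eq_iff)
    then have "fs.dim (?T ` V) \<noteq> 0" using dim_eq_0_fin_dim[OF fd] g(1) by blast
    then have lt: "fs.dim ?N < fs.dim V"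
      using rank_nullity[OF lin less.prems] by linarith
    have "fs.subspace ?N"
      using less.prems(1) unfolding fs.subspace_def by (auto simp: fun_eq_iff)
    then obtain S where S: "finite S" "card S \<le> fs.dim ?N"
        "\<forall>f\<in>?N. (\<forall>x\<in>S. f x = 0) \<longrightarrow> f = 0"
      using less.hyps[OF lt] fin_dim_subset[OF less.prems(2)] by fastforce
    have "card (insert x S) \<le> fs.dim V"
      using card_insert_le_m1[of "fs.dim V" S x] S(2) lt by linarith
    then show ?thesis using S(1,3)
      by (intro exI[of _ "insert x S"]) (auto simp: fun_eq_iff)
  qed
qed

section \<open>Independence and genericity along lines\<close>

definition indep_on :: "'i set \<Rightarrow> ('i \<Rightarrow> 'j \<Rightarrow> 'k::field) \<Rightarrow> bool" where
  "indep_on I v \<longleftrightarrow> (\<forall>c. (\<forall>j. (\<Sum>i\<in>I. c i * v i j) = 0) \<longrightarrow> (\<forall>i\<in>I. c i = 0))"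

lemma indep_onD: "indep_on I v \<Longrightarrow> (\<And>j. (\<Sum>i\<in>I. c i * v i j) = 0) \<Longrightarrow> i \<in> I \<Longrightarrow> c i = 0"
  unfolding indep_on_def by blast

text \<open>Gaussian elimination of one vector, cross-multiplied so that the entries stay polynomial.\<close>

lemma indep_on_poly_cofinite:
  fixes v :: "'i \<Rightarrow> 'j \<Rightarrow> 'k::field poly"
  assumes "finite I" "indep_on I (\<lambda>i j. poly (v i j) s)"
  shows "finite {t. \<not> indep_on I (\<lambda>i j. poly (v i j) t)}"
  using assms
proof (induction I arbitrary: v rule: finite_induct)
  case empty
  then show ?case by (simp add: indep_on_def)
next
  case (insert a I)
  have "\<exists>j. poly (v a j) s \<noteq> 0"
  proof (rule ccontr)
    assume "\<not> ?thesis"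
    then have "(\<Sum>i\<in>insert a I. (if i = a then 1 else 0) * poly (v i j) s) = 0" for j
      by (intro sum.neutral) auto
    from indep_onD[OF insert.prems this, of a] show False by simp
  qed
  then obtain j where j: "poly (v a j) s \<noteq> 0" by blast
  define w where "w = (\<lambda>i l. v a j * v i l - v i j * v a l)"
  have w: "(\<Sum>i\<in>I. c i * poly (w i l) t) =
      poly (v a j) t * (\<Sum>i\<in>I. c i * poly (v i l) t) - (\<Sum>i\<in>I. c i * poly (v i j) t) * poly (v a l) t"
    for c l t
    by (simp add: w_def sum_distrib_left sum_distrib_right sum_subtractf algebra_simps)
  have "indep_on I (\<lambda>i l. poly (w i l) s)"
    unfolding indep_on_def
  proof (intro allI impI ballI)
    fix c i assume c: "\<forall>l. (\<Sum>i\<in>I. c i * poly (w i l) s) = 0" and i: "i \<in> I"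
    \<comment> \<open>A relation \<open>c\<close> among the eliminated vectors lifts to a relation
      \<open>d\<close> among the original ones; the coefficient at \<open>a\<close> collects the
      subtracted multiples of \<open>v a\<close>.\<close>
    define d where "d = (\<lambda>i. if i = a then - (\<Sum>i\<in>I. c i * poly (v i j) s) else poly (v a j) s * c i)"
    have "(\<Sum>i\<in>insert a I. d i * poly (v i l) s) = 0" for l
    proof -
      have "(\<Sum>i\<in>I. d i * poly (v i l) s) = (\<Sum>i\<in>I. poly (v a j) s * (c i * poly (v i l) s))"
        using insert.hyps(2) by (intro sum.cong) (auto simp: d_def)
      then have "(\<Sum>i\<in>insert a I. d i * poly (v i l) s) = (\<Sum>i\<in>I. c i * poly (w i l) s)"
        using insert.hyps unfolding w by (simp add: d_def sum_distrib_left)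
      then show ?thesis using c by simp
    qed
    from indep_onD[OF insert.prems this, of i] i insert.hyps(2) j show "c i = 0"
      by (auto simp: d_def split: if_splits)
  qed
  then have fin: "finite {t. \<not> indep_on I (\<lambda>i l. poly (w i l) t)}" by (rule insert.IH)
  have "v a j \<noteq> 0" using j by auto
  then have fin2: "finite {t. poly (v a j) t = 0}" by (rule poly_roots_finite)
  have "indep_on (insert a I) (\<lambda>i l. poly (v i l) t)"
    if t: "indep_on I (\<lambda>i l. poly (w i l) t)" "poly (v a j) t \<noteq> 0" for t
    unfolding indep_on_def
  proof (intro allI impI)
    fix c assume c: "\<forall>l. (\<Sum>i\<in>insert a I. c i * poly (v i l) t) = 0"
    then have c': "(\<Sum>i\<in>I. c i * poly (v i l) t) = - c a * poly (v a l) t" for l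
      using insert.hyps by (simp add: eq_neg_iff_add_eq_0 add.commute)
    have "(\<Sum>i\<in>I. c i * poly (w i l) t) = 0" for l
      unfolding w c' by simp
    from indep_onD[OF t(1) this] have z: "\<forall>i\<in>I. c i = 0" by blast
    with c'[of j] t(2) have "c a = 0" by simp
    with z show "\<forall>i\<in>insert a I. c i = 0" by simp
  qed
  then have "{t. \<not> indep_on (insert a I) (\<lambda>i l. poly (v i l) t)} \<subseteq>
      {t. \<not> indep_on I (\<lambda>i l. poly (w i l) t)} \<union> {t. poly (v a j) t = 0}"
    by blast
  then show ?case using fin fin2 finite_subset by blast
qed

lemma indep_on_image:
  fixes v :: "'i \<Rightarrow> 'j \<Rightarrow> 'k::field"
  assumes "finite I" "indep_on I v"
  shows "inj_on v I" "fs.independent (v ` I)"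
proof -
  have "\<forall>i\<in>I. c i = 0" if "(\<Sum>i\<in>I. fscale (c i) (v i)) = 0" for c
    using indep_onD[OF assms(2), of c] fun_cong[OF that] by (auto simp: sum_fun_apply)
  then show "inj_on v I" "fs.independent (v ` I)"
    using indep_family_image[OF assms(1), of v] by blast+
qed

lemma independent_indep_on:
  assumes "finite B" "fs.independent B"
  shows "indep_on B (\<lambda>b. b)"
  unfolding indep_on_def
proof (intro allI impI)
  fix c assume "\<forall>j. (\<Sum>b\<in>B. c b * b j) = 0"
  then have "(\<Sum>b\<in>B. fscale (c b) b) = 0" by (simp add: fun_eq_iff sum_fun_apply)
  then show "\<forall>b\<in>B. c b = 0" using fs.independentD[OF assms(2,1) order_refl] by blast
qed

lemma indep_on_card_le_dim:
  assumes "finite I" "indep_on I v" "v ` I \<subseteq> V" "fin_dim V"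
  shows "card I \<le> fs.dim V"
  using card_le_dim_fin_dim[OF assms(4,3)] indep_on_image[OF assms(1,2)] by (simp add: card_image)

text \<open>Stands in for Zariski openness: a condition that holds somewhere fails at only finitely
  many points of each line through a point where it holds.\<close>

definition open_on_lines :: "((nat \<Rightarrow> 'k::field) \<Rightarrow> bool) \<Rightarrow> bool" where
  "open_on_lines P \<longleftrightarrow> (\<forall>x y. P x \<longrightarrow> finite {t. \<not> P (\<lambda>i. x i + t * y i)})"

text \<open>On the line joining \<open>x\<close> and \<open>y\<close> each condition has finitely
  many exceptions, and an infinite field leaves a common good point. The line is parametrized from
  both ends, whence \<open>1 - t\<close>.\<close>

lemma open_on_lines_common_point:
  fixes P Q :: "(nat \<Rightarrow> 'k::field_char_0) \<Rightarrow> bool"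
  assumes "open_on_lines P" "open_on_lines Q" "P x" "Q y"
  shows "\<exists>z. P z \<and> Q z"
proof -
  let ?A = "{t. \<not> P (\<lambda>i. x i + t * (y i - x i))}"
  let ?B = "{t. \<not> Q (\<lambda>i. y i + t * (x i - y i))}"
  have "finite (?A \<union> (\<lambda>s. 1 - s) ` ?B)"
    using assms unfolding open_on_lines_def by auto
  then obtain t where t: "t \<notin> ?A" "t \<notin> (\<lambda>s. 1 - s) ` ?B"
    using ex_new_if_finite[OF infinite_UNIV_char_0] by blast
  have "1 - t \<notin> ?B" using t(2) by (metis (no_types, lifting) diff_diff_eq2 add_diff_cancel_left' image_eqI)
  moreover have "(\<lambda>i. y i + (1 - t) * (x i - y i)) = (\<lambda>i. x i + t * (y i - x i))"
    by (auto simp: algebra_simps)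
  ultimately show ?thesis using t(1) by auto
qed

section \<open>Contraction of forms\<close>

type_synonym mon = "nat \<Rightarrow>\<^sub>0 nat"

abbreviation xvar :: "nat \<Rightarrow> mon" where
  "xvar j \<equiv> Poly_Mapping.single j (Suc 0)"

lemma mdeg_eq_sum:
  assumes "finite S" "Poly_Mapping.keys m \<subseteq> S"
  shows "mdeg m = (\<Sum>j\<in>S. Poly_Mapping.lookup m j)"
  unfolding mdeg_def using assms
  by (intro sum.mono_neutral_left) (auto simp: in_keys_iff)

lemma mdeg_add: "mdeg (m + n) = mdeg m + mdeg n"
proof -
  let ?S = "Poly_Mapping.keys m \<union> Poly_Mapping.keys n"
  have "mdeg (m + n) = (\<Sum>j\<in>?S. Poly_Mapping.lookup (m + n) j)"
    by (intro mdeg_eq_sum keys_add) auto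
  also have "\<dots> = mdeg m + mdeg n"
    by (subst (1 2) mdeg_eq_sum[of ?S]) (auto simp: lookup_add sum.distrib)
  finally show ?thesis .
qed

lemma mdeg_zero [simp]: "mdeg 0 = 0"
  by (simp add: mdeg_def)

lemma mdeg_xvar [simp]: "mdeg (xvar j) = 1"
  by (simp add: mdeg_def)

lemma mdeg_eq_0_iff [simp]: "mdeg m = 0 \<longleftrightarrow> m = 0"
proof
  assume "mdeg m = 0"
  then have "\<forall>j\<in>Poly_Mapping.keys m. Poly_Mapping.lookup m j = 0"
    unfolding mdeg_def by simp
  then show "m = 0" by (auto simp: poly_mapping_eq_iff fun_eq_iff in_keys_iff)
qed simp

lemma keys_add_nat: "Poly_Mapping.keys (m + n :: 'a \<Rightarrow>\<^sub>0 nat) = Poly_Mapping.keys m \<union> Poly_Mapping.keys n"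
  by (auto simp: in_keys_iff lookup_add)

lemma mon_split_key:
  assumes "j \<in> Poly_Mapping.keys (m :: mon)"
  obtains n where "m = n + xvar j"
proof
  show "m = (m - xvar j) + xvar j"
    using assms by (auto simp: poly_mapping_eq_iff fun_eq_iff lookup_add lookup_minus lookup_single
        in_keys_iff when_def)
qed

definition mons :: "nat \<Rightarrow> nat \<Rightarrow> mon set" where
  "mons r d = {m. mdeg m = d \<and> Poly_Mapping.keys m \<subseteq> {..<r}}"

lemma add_mons: "m \<in> mons r d \<Longrightarrow> n \<in> mons r e \<Longrightarrow> m + n \<in> mons r (d + e)"
  by (auto simp: mons_def mdeg_add keys_add_nat)

lemma xvar_mons [simp]: "xvar j \<in> mons r (Suc 0) \<longleftrightarrow> j < r"
  by (simp add: mons_def)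

lemma mons_0: "mons r 0 = {0}"
  by (auto simp: mons_def)

lemma mons_SucE:
  assumes "m \<in> mons r (Suc d)"
  obtains j n where "j < r" "n \<in> mons r d" "m = n + xvar j"
proof -
  have "m \<noteq> 0" using assms by (auto simp: mons_def)
  then have "Poly_Mapping.keys m \<noteq> {}" by (auto simp: poly_mapping_eq_iff fun_eq_iff in_keys_iff)
  then obtain j where j: "j \<in> Poly_Mapping.keys m" by blast
  then obtain n where n: "m = n + xvar j" by (rule mon_split_key)
  show thesis
  proof (rule that[of j n])
    show "j < r" "n \<in> mons r d"
      using j assms unfolding n by (auto simp: mons_def mdeg_add keys_add_nat)
  qed (rule n)
qed

lemma mons_1: "mons r (Suc 0) = xvar ` {..<r}"
proof
  show "mons r (Suc 0) \<subseteq> xvar ` {..<r}"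
  proof
    fix m assume "m \<in> mons r (Suc 0)"
    then obtain j n where "j < r" "n \<in> mons r 0" "m = n + xvar j" by (rule mons_SucE)
    then show "m \<in> xvar ` {..<r}" by (simp add: mons_0)
  qed
qed auto

lemma finite_mons: "finite (mons r d)"
proof (induction d)
  case (Suc d)
  have "mons r (Suc d) \<subseteq> (\<lambda>(n, j). n + xvar j) ` (mons r d \<times> {..<r})"
  proof
    fix m assume "m \<in> mons r (Suc d)"
    then obtain j n where "j < r" "n \<in> mons r d" "m = n + xvar j" by (rule mons_SucE)
    then show "m \<in> (\<lambda>(n, j). n + xvar j) ` (mons r d \<times> {..<r})" by force
  qed
  then show ?case using Suc finite_subset by blast
qed (simp add: mons_0)

text \<open>Counts unordered pairs: by commutativity a new element contributes at most
  \<open>card J + 1\<close> new sums.\<close>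

lemma finite_sums_card:
  fixes J :: "'a::ab_semigroup_add set"
  assumes "finite J"
  shows "finite {m + n |m n. m \<in> J \<and> n \<in> J} \<and>
    card {m + n |m n. m \<in> J \<and> n \<in> J} \<le> card J * (card J + 1) div 2"
  using assms
proof (induction J rule: finite_induct)
  case (insert a J)
  let ?S = "{m + n |m n. m \<in> J \<and> n \<in> J}"
  have eq: "{m + n |m n. m \<in> insert a J \<and> n \<in> insert a J} = ?S \<union> (+) a ` insert a J"
    by (auto simp: image_iff) (metis add.commute)
  have "card ((+) a ` insert a J) \<le> Suc (card J)"
    using card_image_le[of "insert a J" "(+) a"] insert.hyps by simp
  then have "card (?S \<union> (+) a ` insert a J) \<le> card J * (card J + 1) div 2 + Suc (card J)"
    using card_Un_le[of ?S "(+) a ` insert a J"] insert.IH by linarith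
  also have "\<dots> = Suc (card J) * (Suc (card J) + 1) div 2"
    by (simp add: algebra_simps)
  finally show ?case using insert.hyps insert.IH unfolding eq by simp
qed auto

text \<open>Forms of degree \<open>d\<close> in the inverse system: functions on the monomials, on which
  the polynomial ring acts by contraction.\<close>

definition invsys :: "nat \<Rightarrow> nat \<Rightarrow> (mon \<Rightarrow> 'k::field) set" where
  "invsys r d = {f. \<forall>m. m \<notin> mons r d \<longrightarrow> f m = 0}"

text \<open>The action of the linear form with coefficient vector \<open>a\<close>. Unlike
  differentiation it produces no exponents as factors, so \<open>f\<close> is best read as a linear
  functional on forms.\<close>

definition contr :: "nat \<Rightarrow> (nat \<Rightarrow> 'k::field) \<Rightarrow> (mon \<Rightarrow> 'k) \<Rightarrow> mon \<Rightarrow> 'k" where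
  "contr r a f = (\<lambda>m. \<Sum>j<r. a j * f (m + xvar j))"

lemma subspace_invsys: "fs.subspace (invsys r d)"
  unfolding fs.subspace_def invsys_def by auto

lemma fin_dim_invsys: "fin_dim (invsys r d)"
  unfolding invsys_def by (rule fin_dim_finite_support(1)[OF finite_mons])

lemma fin_dim_le_invsys: "V \<subseteq> invsys r d \<Longrightarrow> fin_dim V"
  using fin_dim_subset[OF fin_dim_invsys] .

lemma linear_contr: "Vector_Spaces.linear fscale fscale (contr r a)"
  by (rule fs_linearI) (auto simp: contr_def fun_eq_iff algebra_simps sum.distrib sum_distrib_left)

lemmas contr_0 [simp] = fsp.linear_0[OF linear_contr]
lemmas contr_add = fsp.linear_add[OF linear_contr]
lemmas contr_scale = fsp.linear_scale[OF linear_contr]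
lemmas contr_subspace = fsp.linear_subspace_image[OF linear_contr]
lemmas contr_rank_nullity = rank_nullity[OF linear_contr]

lemma contr_line: "contr r (\<lambda>i. a i + t * b i) f = contr r a f + fscale t (contr r b f)"
  by (auto simp: contr_def fun_eq_iff algebra_simps sum.distrib sum_distrib_left)

lemma contr_commute: "contr r a (contr r b f) = contr r b (contr r a f)"
proof
  fix m
  have "contr r a (contr r b f) m = (\<Sum>i<r. \<Sum>j<r. a i * b j * f (m + xvar i + xvar j))"
    by (simp add: contr_def sum_distrib_left mult.assoc)
  also have "\<dots> = (\<Sum>j<r. \<Sum>i<r. a i * b j * f (m + xvar i + xvar j))"
    by (rule sum.swap)
  also have "\<dots> = contr r b (contr r a f) m"
    by (simp add: contr_def sum_distrib_left ac_simps)
  finally show "contr r a (contr r b f) m = contr r b (contr r a f) m" .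
qed

lemma contr_image_commute: "contr r a ` contr r b ` V = contr r b ` contr r a ` V"
  unfolding image_image contr_commute[of r a b] ..

lemma contr_invsys:
  assumes "f \<in> invsys r (Suc d)"
  shows "contr r a f \<in> invsys r d"
proof -
  have "f (m + xvar j) = 0" if "m \<notin> mons r d" "j < r" for m j
  proof -
    have "m + xvar j \<notin> mons r (Suc d)"
      using that by (auto simp: mons_def mdeg_add keys_add_nat)
    then show ?thesis using assms by (simp add: invsys_def)
  qed
  then show ?thesis by (auto simp: invsys_def contr_def intro!: sum.neutral)
qed

lemma contr_image_invsys: "V \<subseteq> invsys r (Suc d) \<Longrightarrow> contr r a ` V \<subseteq> invsys r d"
  using contr_invsys by blast

definition unit_dir :: "nat \<Rightarrow> nat \<Rightarrow> 'k::field" where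
  "unit_dir j = (\<lambda>i. if i = j then 1 else 0)"

lemma contr_unit_dir: "j < r \<Longrightarrow> contr r (unit_dir j) f m = f (m + xvar j)"
  by (simp add: contr_def unit_dir_def if_distrib[of "\<lambda>x. x * _"] cong: if_cong)

text \<open>Every monomial of positive degree is divisible by a variable. Constants are killed by
  all contractions, hence the degree \<open>Suc d\<close>.\<close>

lemma invsys_eq_0I:
  assumes "f \<in> invsys r (Suc d)" "\<And>j. j < r \<Longrightarrow> contr r (unit_dir j) f = 0"
  shows "f = 0"
proof
  fix m show "f m = 0 m"
  proof (cases "m \<in> mons r (Suc d)")
    case True
    then obtain j n where "j < r" "m = n + xvar j" by (rule mons_SucE)
    then show ?thesis using fun_cong[OF assms(2), of j n] by (simp add: contr_unit_dir)
  qed (use assms(1) in \<open>simp add: invsys_def\<close>)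
qed

lemma subspace_kernel_contr: "fs.subspace V \<Longrightarrow> fs.subspace {v \<in> V. contr r a v = 0}"
  unfolding fs.subspace_def by (auto simp: contr_add contr_scale)

text \<open>Semicontinuity of rank: preimages of a basis of the image of \<open>x\<close> are sent
  by \<open>x + t y\<close> to vectors affine in \<open>t\<close> that are independent at
  \<open>t = 0\<close>, hence for all but finitely many \<open>t\<close>.\<close>

lemma open_on_lines_rank:
  assumes V: "V \<subseteq> invsys r d"
  shows "open_on_lines (\<lambda>x. k \<le> fs.dim (contr r x ` V))"
  unfolding open_on_lines_def
proof (intro allI impI)
  fix x y assume k: "k \<le> fs.dim (contr r x ` V)"
  have fd: "fin_dim (contr r z ` V)" for z
    by (rule fin_dim_image[OF linear_contr fin_dim_le_invsys[OF V]])
  obtain B where B: "finite B" "B \<subseteq> contr r x ` V" "fs.independent B"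
      "card B = fs.dim (contr r x ` V)"
    using fin_dim_basis[OF fd] by metis
  have "\<forall>b\<in>B. \<exists>v\<in>V. contr r x v = b" using B(2) by auto
  then obtain g where g: "\<And>b. b \<in> B \<Longrightarrow> g b \<in> V" "\<And>b. b \<in> B \<Longrightarrow> contr r x (g b) = b" by metis
  define v where "v = (\<lambda>b m. [: b m, contr r y (g b) m :])"
  have "indep_on B (\<lambda>b m. poly (v b m) 0)"
    using independent_indep_on[OF B(1,3)] by (simp add: v_def)
  from indep_on_poly_cofinite[OF B(1) this]
  have fin: "finite {t. \<not> indep_on B (\<lambda>b m. poly (v b m) t)}" .
  have "k \<le> fs.dim (contr r (\<lambda>i. x i + t * y i) ` V)"
    if "indep_on B (\<lambda>b m. poly (v b m) t)" for t
  proof -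
    have "(\<lambda>m. poly (v b m) t) = contr r (\<lambda>i. x i + t * y i) (g b)" if "b \<in> B" for b
      using that g(2) by (auto simp: v_def contr_line fun_eq_iff)
    then have "(\<lambda>b m. poly (v b m) t) ` B \<subseteq> contr r (\<lambda>i. x i + t * y i) ` V"
      using g(1) by auto
    from indep_on_card_le_dim[OF B(1) that this fd] show ?thesis using k B(4) by simp
  qed
  then have "{t. \<not> k \<le> fs.dim (contr r (\<lambda>i. x i + t * y i) ` V)} \<subseteq>
      {t. \<not> indep_on B (\<lambda>b m. poly (v b m) t)}" by blast
  then show "finite {t. \<not> k \<le> fs.dim (contr r (\<lambda>i. x i + t * y i) ` V)}"
    using fin finite_subset by blast
qed

text \<open>Along a line, one coefficient of the square applied to \<open>q\<close> is a quadratic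
  polynomial in \<open>t\<close> whose constant term is nonzero.\<close>

lemma open_on_lines_square_nonzero:
  "open_on_lines (\<lambda>x. \<exists>q\<in>U. contr r x (contr r x q) \<noteq> 0)"
  unfolding open_on_lines_def
proof (intro allI impI)
  fix x y assume "\<exists>q\<in>U. contr r x (contr r x q) \<noteq> 0"
  then obtain q m where q: "q \<in> U" "contr r x (contr r x q) m \<noteq> 0" by (auto simp: fun_eq_iff)
  define p where "p = [: contr r x (contr r x q) m, contr r x (contr r y q) m + contr r y (contr r x q) m,
      contr r y (contr r y q) m :]"
  have p: "contr r (\<lambda>i. x i + t * y i) (contr r (\<lambda>i. x i + t * y i) q) m = poly p t" for t
    by (simp add: p_def contr_line contr_add contr_scale algebra_simps)
  have "p \<noteq> 0" using q(2) by (auto simp: p_def)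
  then have "finite {t. poly p t = 0}" by (rule poly_roots_finite)
  moreover have "{t. \<not> (\<exists>q\<in>U. contr r (\<lambda>i. x i + t * y i) (contr r (\<lambda>i. x i + t * y i) q) \<noteq> 0)}
      \<subseteq> {t. poly p t = 0}"
    using q(1) unfolding p[symmetric] by (auto simp: fun_eq_iff)
  ultimately show "finite {t. \<not> (\<exists>q\<in>U. contr r (\<lambda>i. x i + t * y i) (contr r (\<lambda>i. x i + t * y i) q) \<noteq> 0)}"
    using finite_subset by blast
qed

text \<open>First-order perturbation: \<open>(x + t y) q = t (y q)\<close>, so a vector \<open>y q\<close> outside the image of
  \<open>x\<close> would raise the rank at \<open>x + t y\<close>.\<close>

lemma contr_kernel_in_image_of_max_rank:
  fixes U :: "(mon \<Rightarrow> 'k::field_char_0) set"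
  assumes U: "fs.subspace U" "U \<subseteq> invsys r d"
    and max: "\<And>z. fs.dim (contr r z ` U) \<le> fs.dim (contr r x ` U)"
    and q: "q \<in> U" "contr r x q = 0"
  shows "contr r y q \<in> contr r x ` U"
proof (rule ccontr)
  assume notin: "contr r y q \<notin> contr r x ` U"
  have fd: "fin_dim (contr r z ` U)" for z
    by (rule fin_dim_image[OF linear_contr fin_dim_le_invsys[OF U(2)]])
  obtain B where B: "finite B" "B \<subseteq> contr r x ` U" "fs.independent B"
      "card B = fs.dim (contr r x ` U)"
    using fin_dim_basis[OF fd] by metis
  have "\<forall>b\<in>B. \<exists>v\<in>U. contr r x v = b" using B(2) by auto
  then obtain g where g: "\<And>b. b \<in> B \<Longrightarrow> g b \<in> U" "\<And>b. b \<in> B \<Longrightarrow> contr r x (g b) = b" by metis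
  define c where "c = contr r y q"
  have cB: "c \<notin> fs.span B"
    using notin fs.span_minimal[OF B(2) contr_subspace[OF U(1)]] unfolding c_def by blast
  then have cnB: "c \<notin> B" using fs.span_base by blast
  have ind: "fs.independent (insert c B)" using cB B(3) by (rule fs.independent_insertI)
  \<comment> \<open>At \<open>t = 0\<close> this family is the independent set
    \<open>insert c B\<close>. The vector \<open>c\<close> stays constant because, for
    \<open>t \<noteq> 0\<close>, it is the image of \<open>q / t\<close> under
    \<open>x + t y\<close>.\<close>
  define v where "v = (\<lambda>b m. if b = c then [: c m :] else [: b m, contr r y (g b) m :])"
  have "(\<lambda>b m. poly (v b m) 0) = (\<lambda>b. b)" by (auto simp: v_def fun_eq_iff)
  then have "indep_on (insert c B) (\<lambda>b m. poly (v b m) 0)"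
    using independent_indep_on[OF _ ind] B(1) by simp
  from indep_on_poly_cofinite[OF _ this] B(1)
  have "finite ({0} \<union> {t. \<not> indep_on (insert c B) (\<lambda>b m. poly (v b m) t)})" by simp
  then obtain t where t: "t \<noteq> 0" "indep_on (insert c B) (\<lambda>b m. poly (v b m) t)"
    using ex_new_if_finite[OF infinite_UNIV_char_0] by blast
  let ?z = "\<lambda>i. x i + t * y i"
  have "(\<lambda>m. poly (v b m) t) \<in> contr r ?z ` U" if "b \<in> insert c B" for b
  proof (cases "b = c")
    case True
    have "contr r ?z (fscale (1 / t) q) = c"
      using t(1) q(2) by (auto simp: contr_line contr_scale c_def fun_eq_iff)
    moreover have "fscale (1 / t) q \<in> U" using U(1) q(1) by (rule fs.subspace_scale)
    moreover have "(\<lambda>m. poly (v b m) t) = c" using True by (simp add: v_def)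
    ultimately show ?thesis by (metis image_eqI)
  next
    case False
    then have "(\<lambda>m. poly (v b m) t) = contr r ?z (g b)"
      using that g(2) by (auto simp: v_def contr_line fun_eq_iff)
    then show ?thesis using False that g(1) by auto
  qed
  then have "card (insert c B) \<le> fs.dim (contr r ?z ` U)"
    using indep_on_card_le_dim[OF _ t(2) _ fd] B(1) by blast
  then show False using max[of ?z] B(1,4) cnB by simp
qed

text \<open>A quadric whose contractions all lie in \<open>W\<close> behaves like an element of the
  symmetric square of \<open>W\<close>: if \<open>J\<close> separates the elements of
  \<open>W\<close>, its values at sums of two members of \<open>J\<close> determine it.\<close>

lemma dim_quadrics_le:
  assumes P: "fs.subspace P" "P \<subseteq> invsys r 2" and W: "fs.subspace W" "W \<subseteq> invsys r 1"
    and PW: "\<And>q y. q \<in> P \<Longrightarrow> contr r y q \<in> W"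
  shows "fs.dim P \<le> fs.dim W * (fs.dim W + 1) div 2"
proof -
  obtain J where J: "finite J" "card J \<le> fs.dim W" "\<And>f. f \<in> W \<Longrightarrow> (\<forall>x\<in>J. f x = 0) \<Longrightarrow> f = 0"
    using ex_separating_coordinates[OF W(1) fin_dim_le_invsys[OF W(2)]] by blast
  let ?S = "{m + n |m n. m \<in> J \<and> n \<in> J}"
  have "fs.dim P \<le> card ?S"
  proof (rule dim_le_separating_coordinates[OF P(1) fin_dim_le_invsys[OF P(2)]])
    show "finite ?S" using finite_sums_card[OF J(1)] by blast
    fix q assume q: "q \<in> P" "\<forall>m\<in>?S. q m = 0"
    have q2: "q \<in> invsys r (Suc 1)" using q(1) P(2) by (auto simp: numeral_2_eq_2)
    have W0: "contr r (unit_dir i) q = 0"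
      if i: "i < r" and z: "\<And>j. j < r \<Longrightarrow> xvar j \<in> J \<Longrightarrow> q (xvar j + xvar i) = 0" for i
    proof (rule J(3)[OF PW[OF q(1)]], rule ballI)
      fix m assume m: "m \<in> J"
      show "contr r (unit_dir i) q m = 0"
      proof (cases "m \<in> mons r (Suc 0)")
        case True
        then show ?thesis using m z i by (auto simp: mons_1 contr_unit_dir)
      next
        case False
        then show ?thesis using contr_invsys[OF q2] by (auto simp: invsys_def)
      qed
    qed
    \<comment> \<open>First the directions indexed by \<open>J\<close>. Symmetry of
      \<open>q (xvar j + xvar i)\<close> then makes every other contraction vanish on
      \<open>J\<close>.\<close>
    have z: "contr r (unit_dir j) q = 0" if "j < r" "xvar j \<in> J" for j
      using that q(2) by (intro W0) blast+
    show "q = 0"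
    proof (rule invsys_eq_0I[OF q2])
      fix i assume i: "i < r"
      show "contr r (unit_dir i) q = 0"
      proof (rule W0[OF i])
        fix j assume j: "j < r" "xvar j \<in> J"
        show "q (xvar j + xvar i) = 0"
          using fun_cong[OF z[OF j], of "xvar i"] j(1) by (simp add: contr_unit_dir add.commute)
      qed
    qed
  qed
  also have "\<dots> \<le> card J * (card J + 1) div 2" using finite_sums_card[OF J(1)] by blast
  also have "\<dots> \<le> fs.dim W * (fs.dim W + 1) div 2"
    using J(2) by (intro div_le_mono mult_le_mono) auto
  finally show ?thesis .
qed

lemma ex_max_rank:
  assumes "V \<subseteq> invsys r d"
  obtains x where "\<And>z. fs.dim (contr r z ` V) \<le> fs.dim (contr r x ` V)"
proof -
  have fd: "fin_dim V" by (rule fin_dim_le_invsys[OF assms])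
  have "fs.dim (contr r z ` V) \<le> fs.dim V" for z
  proof -
    obtain B where B: "finite B" "V \<subseteq> fs.span B" "card B = fs.dim V" using fin_dim_basis[OF fd] by metis
    have "contr r z ` V \<subseteq> fs.span (contr r z ` B)"
      using B(2) fsp.linear_span_image[OF linear_contr] by blast
    then have "fs.dim (contr r z ` V) \<le> card (contr r z ` B)"
      using B(1) by (intro fs.dim_le_card) auto
    also have "\<dots> \<le> fs.dim V" using card_image_le[OF B(1)] B(3) by metis
    finally show ?thesis .
  qed
  then have "\<exists>x. True \<and> (\<forall>z. True \<longrightarrow> fs.dim (contr r z ` V) \<le> fs.dim (contr r x ` V))"
    by (intro ex_has_greatest_nat[where b = "Suc (fs.dim V)"]) (auto simp: le_imp_less_Suc)
  then show thesis using that by blast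
qed

section \<open>Green's restriction theorem in degrees 2 and 3\<close>

text \<open>\<open>tri k\<close> and \<open>tet k\<close> are the numbers of quadratic and of cubic
  monomials in \<open>k\<close> variables, as \<open>card_mons_2\<close> and
  \<open>card_mons_3\<close> confirm.\<close>

definition tri :: "nat \<Rightarrow> nat" where
  "tri k = k * (k + 1) div 2"

primrec tet :: "nat \<Rightarrow> nat" where
  "tet 0 = 0"
| "tet (Suc k) = tet k + tri (Suc k)"

lemma tri_0 [simp]: "tri 0 = 0"
  by (simp add: tri_def)

lemma tri_Suc [simp]: "tri (Suc k) = tri k + Suc k"
  by (simp add: tri_def algebra_simps)

lemma tri_mono: "a \<le> b \<Longrightarrow> tri a \<le> tri b"
  unfolding tri_def by (intro div_le_mono mult_le_mono) auto

lemma less_if_tri_less: "tri a < n \<Longrightarrow> n \<le> tri b \<Longrightarrow> a < b"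
  using tri_mono[of b a] by (meson leD not_le_imp_less order_less_le_trans)

text \<open>Polarization: the mixed contraction occurs twice in the square of \<open>y + z\<close>,
  and 2 is invertible.\<close>

lemma square_zero_imp_zero:
  fixes q :: "mon \<Rightarrow> 'k::field_char_0"
  assumes q: "q \<in> invsys r 2" and sq: "\<And>x. contr r x (contr r x q) = 0"
  shows "q = 0"
proof -
  have q2: "q \<in> invsys r (Suc (Suc 0))" using q by (simp add: numeral_2_eq_2)
  have pol: "contr r y (contr r z q) = 0" for y z
  proof -
    have "contr r (\<lambda>i. y i + 1 * z i) (contr r (\<lambda>i. y i + 1 * z i) q) =
        contr r y (contr r z q) + contr r y (contr r z q)"
      unfolding contr_line by (simp add: contr_add sq contr_commute[of r z y])
    then have "2 * contr r y (contr r z q) m = 0" for m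
      using sq[of "\<lambda>i. y i + 1 * z i"] by (simp add: fun_eq_iff)
    then show ?thesis by (auto simp: fun_eq_iff)
  qed
  show ?thesis
    by (rule invsys_eq_0I[OF q2], rule invsys_eq_0I[OF contr_invsys[OF q2]]) (rule pol)
qed

text \<open>Green's bound in degree 2, read dually: for dimension \<open>c\<close> its Macaulay representation gives
  \<open>c - \<rho>\<close> with the least \<open>\<rho>\<close> such that \<open>c \<le> tri \<rho>\<close>.\<close>

theorem green_quadrics:
  fixes U :: "(mon \<Rightarrow> 'k::field_char_0) set"
  assumes U: "fs.subspace U" "U \<subseteq> invsys r 2"
    and rank: "\<And>z. fs.dim (contr r z ` U) \<le> \<rho>"
  shows "fs.dim U \<le> tri \<rho>"
proof (cases "U \<subseteq> {0}")
  case True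
  then have "fs.dim U \<le> card ({} :: (mon \<Rightarrow> 'k) set)" by (intro fs.dim_le_card) auto
  then show ?thesis by simp
next
  case False
  then obtain q0 where "q0 \<in> U" "q0 \<noteq> 0" by auto
  then obtain y where y: "\<exists>q\<in>U. contr r y (contr r y q) \<noteq> 0"
    using square_zero_imp_zero[of q0 r] U(2) by blast
  have U2: "U \<subseteq> invsys r (Suc 1)" using U(2) by (simp add: numeral_2_eq_2)
  obtain x where x: "\<And>z. fs.dim (contr r z ` U) \<le> fs.dim (contr r x ` U)"
    using ex_max_rank[OF U(2)] by blast
  \<comment> \<open>The form \<open>w\<close> has maximal rank and, in addition, a square that does
    not annihilate \<open>U\<close>.\<close>
  obtain w where w: "fs.dim (contr r x ` U) \<le> fs.dim (contr r w ` U)"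
      "\<exists>q\<in>U. contr r w (contr r w q) \<noteq> 0"
    using open_on_lines_common_point[OF open_on_lines_rank[OF U(2)] open_on_lines_square_nonzero
        order_refl y] by blast
  have max: "fs.dim (contr r z ` U) \<le> fs.dim (contr r w ` U)" for z
    using x[of z] w(1) by simp
  define W where "W = contr r w ` U"
  define W' where "W' = {v \<in> W. contr r w v = 0}"
  define K where "K = {q \<in> U. contr r w q = 0}"
  have W: "fs.subspace W" "W \<subseteq> invsys r 1"
    unfolding W_def using contr_subspace[OF U(1)] contr_image_invsys[OF U2] by auto
  have fdW: "fin_dim W" by (rule fin_dim_le_invsys[OF W(2)])
  have rnW: "fs.dim W = fs.dim (contr r w ` W) + fs.dim W'"
    unfolding W'_def by (rule contr_rank_nullity[OF W(1) fdW])
  have "fs.dim (contr r w ` W) \<noteq> 0"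
    using dim_eq_0_fin_dim[OF fin_dim_image[OF linear_contr fdW]] w(2) unfolding W_def by blast
  \<comment> \<open>This strict drop is the reason for asking that \<open>w\<close> have nonzero
    square on \<open>U\<close>: it replaces \<open>tri (fs.dim W)\<close> by
    \<open>tri (fs.dim W - 1)\<close> in the bound for \<open>K\<close>.\<close>
  then have lt: "fs.dim W' < fs.dim W" using rnW by linarith
  have "fs.dim K \<le> fs.dim W' * (fs.dim W' + 1) div 2"
  proof (rule dim_quadrics_le)
    show "fs.subspace K" "fs.subspace W'"
      unfolding K_def W'_def using subspace_kernel_contr U(1) W(1) by blast+
    show "K \<subseteq> invsys r 2" "W' \<subseteq> invsys r 1" using U(2) W(2) by (auto simp: K_def W'_def)
    fix q y assume q: "q \<in> K"
    have "contr r y q \<in> W"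
      unfolding W_def using q by (intro contr_kernel_in_image_of_max_rank[OF U max]) (auto simp: K_def)
    moreover have "contr r w (contr r y q) = 0"
      using q contr_commute[of r w y q] by (simp add: K_def)
    ultimately show "contr r y q \<in> W'" by (simp add: W'_def)
  qed
  then have K: "fs.dim K \<le> tri (fs.dim W')" by (simp add: tri_def)
  obtain s where s: "fs.dim W = Suc s" using lt by (cases "fs.dim W") auto
  have "fs.dim U = fs.dim W + fs.dim K"
    unfolding W_def K_def by (rule contr_rank_nullity[OF U(1) fin_dim_le_invsys[OF U(2)]])
  also have "\<dots> \<le> Suc s + tri s"
    using K s lt tri_mono[of "fs.dim W'" s] by simp
  also have "\<dots> = tri (fs.dim W)" using s by simp
  also have "\<dots> \<le> tri \<rho>" using rank[of w] by (intro tri_mono) (simp add: W_def)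
  finally show ?thesis .
qed

lemma dim_image_contr_le:
  assumes "fs.subspace V" "V \<subseteq> invsys r d"
  shows "fs.dim (contr r z ` V) \<le> fs.dim V"
  using contr_rank_nullity[OF assms(1) fin_dim_le_invsys[OF assms(2)], of r z] by simp

text \<open>For a general pair \<open>x, y\<close>, contraction by \<open>y\<close> maps the kernel of \<open>x\<close> on \<open>V\<close> into the kernel of
  \<open>x\<close> on \<open>y V\<close>, where the bound for quadrics applies.\<close>

lemma green_cubics_step:
  fixes V :: "(mon \<Rightarrow> 'k::field_char_0) set"
  assumes V: "fs.subspace V" "V \<subseteq> invsys r 3"
  obtains x \<tau> where "\<And>z. fs.dim (contr r z ` V) \<le> fs.dim (contr r x ` V)"
    and "fs.dim (contr r x ` V) \<le> tri \<tau>"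
    and "\<And>z. fs.dim (contr r z ` {v \<in> V. contr r x v = 0}) + \<tau> \<le> fs.dim (contr r x ` V)"
proof -
  have V3: "V \<subseteq> invsys r (Suc 2)" using V(2) by (simp add: numeral_3_eq_3)
  have im: "fs.subspace (contr r z ` V)" "contr r z ` V \<subseteq> invsys r 2" for z
    using contr_subspace[OF V(1)] contr_image_invsys[OF V3] by auto
  obtain x1 where x1: "\<And>z. fs.dim (contr r z ` V) \<le> fs.dim (contr r x1 ` V)"
    using ex_max_rank[OF V(2)] by blast
  have "\<exists>ab. True \<and> (\<forall>cd. True \<longrightarrow> fs.dim (contr r (fst cd) ` contr r (snd cd) ` V) \<le>
      fs.dim (contr r (fst ab) ` contr r (snd ab) ` V))"
  proof (rule ex_has_greatest_nat[where b = "Suc (fs.dim V)"])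
    show "\<forall>cd. True \<longrightarrow> fs.dim (contr r (fst cd) ` contr r (snd cd) ` V) < Suc (fs.dim V)"
      by (intro allI impI le_imp_less_Suc order_trans[OF dim_image_contr_le[OF im] dim_image_contr_le[OF V]])
  qed simp
  \<comment> \<open>The pair maximizes the rank of a product of two linear forms on
    \<open>V\<close>; the maximum \<open>\<tau>\<close> bounds every rank on every image, so the
    quadric bound applies with it.\<close>
  then obtain a b where ab: "\<And>c d. fs.dim (contr r c ` contr r d ` V) \<le> fs.dim (contr r a ` contr r b ` V)"
    by auto
  define \<rho> where "\<rho> = fs.dim (contr r x1 ` V)"
  define \<tau> where "\<tau> = fs.dim (contr r a ` contr r b ` V)"
  obtain x where x: "\<rho> \<le> fs.dim (contr r x ` V)" "\<tau> \<le> fs.dim (contr r x ` contr r b ` V)"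
    using open_on_lines_common_point[OF open_on_lines_rank[OF V(2), of \<rho>]
        open_on_lines_rank[OF im(2), of \<tau>], of x1 a] unfolding \<rho>_def \<tau>_def by blast
  have x\<rho>: "fs.dim (contr r x ` V) = \<rho>" using x(1) x1[of x] by (simp add: \<rho>_def)
  have \<rho>\<tau>: "\<rho> \<le> tri \<tau>"
    unfolding \<rho>_def by (rule green_quadrics[OF im]) (simp add: ab \<tau>_def)
  let ?N = "{v \<in> V. contr r x v = 0}"
  have N: "?N \<subseteq> invsys r 3" using V(2) by auto
  have "fs.dim (contr r z ` ?N) + \<tau> \<le> \<rho>" for z
  proof -
    have "\<tau> \<le> fs.dim (contr r b ` contr r x ` V)"
      using x(2) unfolding contr_image_commute[of r b x] .
    \<comment> \<open>A general \<open>y\<close> does at least as well as \<open>z\<close> on the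
      kernel and still has rank at least \<open>\<tau>\<close> on the image of
      \<open>x\<close>.\<close>
    then obtain y where y: "fs.dim (contr r z ` ?N) \<le> fs.dim (contr r y ` ?N)"
        "\<tau> \<le> fs.dim (contr r y ` contr r x ` V)"
      using open_on_lines_common_point[OF open_on_lines_rank[OF N] open_on_lines_rank[OF im(2)]
          order_refl] by blast
    \<comment> \<open>The image of \<open>y\<close> has dimension at most \<open>\<rho>\<close> and
      loses at least \<open>\<tau>\<close> under \<open>x\<close>, which leaves at most
      \<open>\<rho> - \<tau>\<close> for \<open>?Q\<close>.\<close>
    let ?Q = "{q \<in> contr r y ` V. contr r x q = 0}"
    have "contr r y ` ?N \<subseteq> ?Q" by (auto simp: contr_commute[of r x y])
    moreover have "fin_dim ?Q" using im(2) by (intro fin_dim_le_invsys[of _ r 2]) auto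
    ultimately have "fs.dim (contr r y ` ?N) \<le> fs.dim ?Q" by (intro dim_mono_fin_dim)
    moreover have "fs.dim (contr r y ` V) = fs.dim (contr r x ` contr r y ` V) + fs.dim ?Q"
      by (rule contr_rank_nullity[OF im(1) fin_dim_le_invsys[OF im(2)]])
    moreover have "fs.dim (contr r y ` V) \<le> \<rho>" using x1 by (simp add: \<rho>_def)
    moreover have "contr r x ` contr r y ` V = contr r y ` contr r x ` V"
      by (rule contr_image_commute)
    ultimately show ?thesis using y by simp
  qed
  then show thesis using that[of x \<tau>] x1 x\<rho> \<rho>\<tau> unfolding \<rho>_def by simp
qed

text \<open>Here \<open>\<sigma>\<close> is the exact rank at \<open>x\<close>. It is kept apart
  from its cap \<open>\<rho>\<close> because \<open>\<tau>\<close> is controlled only through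
  \<open>\<sigma> \<le> tri \<tau>\<close>, so \<open>\<sigma> - \<tau>\<close> has to be estimated
  case by case.\<close>

lemma green_cubics_le:
  fixes V :: "(mon \<Rightarrow> 'k::field_char_0) set"
  assumes V: "fs.subspace V" "V \<subseteq> invsys r 3"
    and rank: "\<And>z. fs.dim (contr r z ` V) \<le> \<rho>"
  obtains x \<sigma> \<tau> where "fs.subspace {v \<in> V. contr r x v = 0}" "{v \<in> V. contr r x v = 0} \<subseteq> invsys r 3"
    and "fs.dim V = \<sigma> + fs.dim {v \<in> V. contr r x v = 0}" "\<sigma> \<le> \<rho>" "\<sigma> \<le> tri \<tau>"
    and "\<And>z. fs.dim (contr r z ` {v \<in> V. contr r x v = 0}) \<le> \<sigma> - \<tau>"
proof -
  obtain x \<tau> where x: "fs.dim (contr r x ` V) \<le> tri \<tau>"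
      "\<And>z. fs.dim (contr r z ` {v \<in> V. contr r x v = 0}) + \<tau> \<le> fs.dim (contr r x ` V)"
    by (rule green_cubics_step[OF V]) blast
  show thesis
  proof (rule that[of x "fs.dim (contr r x ` V)" \<tau>])
    show "fs.dim (contr r z ` {v \<in> V. contr r x v = 0}) \<le> fs.dim (contr r x ` V) - \<tau>" for z
      using x(2)[of z] by simp
    show "fs.dim V = fs.dim (contr r x ` V) + fs.dim {v \<in> V. contr r x v = 0}"
      by (rule contr_rank_nullity[OF V(1) fin_dim_le_invsys[OF V(2)]])
  qed (use subspace_kernel_contr V rank x(1) in auto)
qed

text \<open>Once \<open>\<sigma>\<close> exceeds \<open>tri k\<close>, \<open>\<tau>\<close> is at
  least \<open>k + 1\<close>, the gap between the consecutive triangular numbers.\<close>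

lemma diff_le_tri:
  assumes "\<sigma> \<le> tri (Suc k)" "\<sigma> \<le> tri \<tau>"
  shows "\<sigma> - \<tau> \<le> tri k"
proof (cases "\<sigma> \<le> tri k")
  case False
  then have "k < \<tau>" using less_if_tri_less[OF _ assms(2)] by simp
  then show ?thesis using assms(1) by simp
qed simp

text \<open>Passing to the kernel of a general form costs at most \<open>tri (Suc k)\<close>
  dimensions and lowers the rank cap to \<open>tri k\<close>; the costs add up to
  \<open>tet\<close>.\<close>

lemma dim_cubics_le_tet:
  fixes V :: "(mon \<Rightarrow> 'k::field_char_0) set"
  assumes "fs.subspace V" "V \<subseteq> invsys r 3" "\<And>z. fs.dim (contr r z ` V) \<le> tri k"
  shows "fs.dim V \<le> tet k"
  using assms
proof (induction k arbitrary: V)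
  case 0
  have "V \<subseteq> {0}"
  proof
    fix v assume v: "v \<in> V"
    have fd: "fin_dim (contr r z ` V)" for z
      by (rule fin_dim_image[OF linear_contr fin_dim_le_invsys[OF "0.prems"(2)]])
    have dim0: "fs.dim (contr r z ` V) = 0" for z
      using "0.prems"(3)[of z] by (simp only: tri_0 le_zero_eq)
    have "contr r z v = 0" for z
      using dim_eq_0_fin_dim[OF fd dim0] v by blast
    then have "v = 0"
      using v "0.prems"(2) by (intro invsys_eq_0I[of v r 2]) (auto simp: numeral_3_eq_3)
    then show "v \<in> {0}" by simp
  qed
  then have "fs.dim V \<le> card ({} :: (mon \<Rightarrow> 'k) set)" by (intro fs.dim_le_card) auto
  then show ?case by (simp del: fscale_apply)
next
  case (Suc k)
  obtain x \<sigma> \<tau> where x: "fs.subspace {v \<in> V. contr r x v = 0}" "{v \<in> V. contr r x v = 0} \<subseteq> invsys r 3"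
      "fs.dim V = \<sigma> + fs.dim {v \<in> V. contr r x v = 0}" "\<sigma> \<le> tri (Suc k)" "\<sigma> \<le> tri \<tau>"
      "\<And>z. fs.dim (contr r z ` {v \<in> V. contr r x v = 0}) \<le> \<sigma> - \<tau>"
    by (rule green_cubics_le[OF Suc.prems]) blast
  have "fs.dim {v \<in> V. contr r x v = 0} \<le> tet k"
    using x(6) diff_le_tri[OF x(4,5)] by (intro Suc.IH[OF x(1,2)]) (meson order_trans)
  then show ?case using x(3,4) by (simp del: fscale_apply)
qed

text \<open>Since 11 is \<open>tri 4 + 1\<close>, rank 11 forces \<open>\<tau> \<ge> 5\<close>, so
  the kernel has ranks at most 6, which is \<open>tri 3\<close>. Thus 21 is 11 +
  \<open>tet 3\<close>.\<close>

lemma dim_cubics_rank_11: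
  fixes V :: "(mon \<Rightarrow> 'k::field_char_0) set"
  assumes V: "fs.subspace V" "V \<subseteq> invsys r 3" "\<And>z. fs.dim (contr r z ` V) \<le> 11"
  shows "fs.dim V \<le> 21"
proof -
  obtain x \<sigma> \<tau> where x: "fs.subspace {v \<in> V. contr r x v = 0}" "{v \<in> V. contr r x v = 0} \<subseteq> invsys r 3"
      "fs.dim V = \<sigma> + fs.dim {v \<in> V. contr r x v = 0}" "\<sigma> \<le> 11" "\<sigma> \<le> tri \<tau>"
      "\<And>z. fs.dim (contr r z ` {v \<in> V. contr r x v = 0}) \<le> \<sigma> - \<tau>"
    by (rule green_cubics_le[OF V]) blast
  have "\<sigma> - \<tau> \<le> tri 3"
  proof (cases "\<sigma> \<le> tri 4")
    case True
    then show ?thesis by (intro diff_le_tri[OF _ x(5)]) (simp add: tri_def)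
  next
    case False
    then have "4 < \<tau>" using less_if_tri_less[OF _ x(5)] by simp
    then show ?thesis using x(4) by (simp add: tri_def)
  qed
  then have "fs.dim {v \<in> V. contr r x v = 0} \<le> tet 3"
    using x(6) by (intro dim_cubics_le_tet[OF x(1,2)]) (meson order_trans)
  then show ?thesis using x(3,4) by (simp add: numeral_3_eq_3)
qed

text \<open>Ranks 16 and 17 exceed \<open>tri 5\<close> and force \<open>\<tau> \<ge> 6\<close>, so
  the kernel has ranks at most 11. Thus 38 is 17 + 21.\<close>

lemma dim_cubics_rank_17:
  fixes V :: "(mon \<Rightarrow> 'k::field_char_0) set"
  assumes V: "fs.subspace V" "V \<subseteq> invsys r 3" "\<And>z. fs.dim (contr r z ` V) \<le> 17"
  shows "fs.dim V \<le> 38"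
proof -
  obtain x \<sigma> \<tau> where x: "fs.subspace {v \<in> V. contr r x v = 0}" "{v \<in> V. contr r x v = 0} \<subseteq> invsys r 3"
      "fs.dim V = \<sigma> + fs.dim {v \<in> V. contr r x v = 0}" "\<sigma> \<le> 17" "\<sigma> \<le> tri \<tau>"
      "\<And>z. fs.dim (contr r z ` {v \<in> V. contr r x v = 0}) \<le> \<sigma> - \<tau>"
    by (rule green_cubics_le[OF V]) blast
  have "\<sigma> - \<tau> \<le> 11"
  proof (cases "\<sigma> \<le> tri 5")
    case True
    then have "\<sigma> - \<tau> \<le> tri 4" by (intro diff_le_tri[OF _ x(5)]) (simp add: tri_def)
    then show ?thesis by (simp add: tri_def)
  next
    case False
    then have "5 < \<tau>" using less_if_tri_less[OF _ x(5)] by simp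
    then show ?thesis using x(4) by simp
  qed
  then have "fs.dim {v \<in> V. contr r x v = 0} \<le> 21"
    using x(6) by (intro dim_cubics_rank_11[OF x(1,2)]) (meson order_trans)
  then show ?thesis using x(3,4) by simp
qed

section \<open>First and second derivatives of a quartic\<close>

lemma linear_contr_dir: "Vector_Spaces.linear fscale fscale (\<lambda>a. contr r a F)"
  by (rule fs_linearI) (auto simp: contr_def fun_eq_iff algebra_simps sum.distrib sum_distrib_left)

text \<open>\<open>contr r\<close> ignores entries from index \<open>r\<close> on. Setting them to 0
  makes the space of directions \<open>r\<close>-dimensional.\<close>

definition dirs :: "nat \<Rightarrow> (nat \<Rightarrow> 'k::field) set" where
  "dirs r = {a. \<forall>i. i \<notin> {..<r} \<longrightarrow> a i = 0}"

lemma dirs_subspace: "fs.subspace (dirs r)"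
  by (auto simp: dirs_def fs.subspace_def)

lemma dirs_fin_dim: "fin_dim (dirs r :: (nat \<Rightarrow> 'k::field) set)"
  and dirs_dim: "fs.dim (dirs r :: (nat \<Rightarrow> 'k::field) set) = r"
  unfolding dirs_def using fin_dim_finite_support[of "{..<r}"] by auto

lemma range_contr_dirs: "range (\<lambda>a. contr r a F) = (\<lambda>a. contr r a F) ` dirs r"
proof
  show "range (\<lambda>a. contr r a F) \<subseteq> (\<lambda>a. contr r a F) ` dirs r"
  proof (rule image_subsetI)
    fix a
    have "contr r a F = contr r (\<lambda>i. if i < r then a i else 0) F" by (simp add: contr_def)
    then show "contr r a F \<in> (\<lambda>a. contr r a F) ` dirs r" by (force simp: dirs_def)
  qed
qed auto

text \<open>Killing \<open>W\<close> amounts to \<open>fs.dim W\<close> linear conditions on a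
  direction, one for each member of a basis.\<close>

lemma dim_add_annihilator_ge:
  fixes W :: "(mon \<Rightarrow> 'k::field) set"
  assumes W: "W \<subseteq> invsys r 1"
  shows "r \<le> fs.dim W + fs.dim {a \<in> dirs r. \<forall>w\<in>W. contr r a w = 0}"
proof -
  obtain B where B: "finite B" "B \<subseteq> W" "W \<subseteq> fs.span B" "card B = fs.dim W"
    using fin_dim_basis[OF fin_dim_le_invsys[OF W]] by metis
  \<comment> \<open>A direction paired with a linear form is a constant, read off at the monomial 1,
    which is written \<open>0\<close> here.\<close>
  define T where "T = (\<lambda>(a :: nat \<Rightarrow> 'k) b. if b \<in> B then contr r a b 0 else 0)"
  have linT: "Vector_Spaces.linear fscale fscale T"
    by (rule fs_linearI)
      (auto simp: T_def contr_def fun_eq_iff algebra_simps sum.distrib sum_distrib_left)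
  have "fs.dim (T ` dirs r) \<le> card B"
    unfolding fin_dim_finite_support(2)[OF B(1), where 'k = 'k, symmetric]
    by (rule dim_mono_fin_dim[OF fin_dim_finite_support(1)[OF B(1)]]) (auto simp: T_def)
  then have "r \<le> fs.dim W + fs.dim {a \<in> dirs r. T a = 0}"
    using rank_nullity[OF linT dirs_subspace dirs_fin_dim, of r] dirs_dim[of r, where 'k = 'k] B(4)
    by simp
  moreover have "{a \<in> dirs r. T a = 0} \<subseteq> {a \<in> dirs r. \<forall>w\<in>W. contr r a w = 0}"
  proof clarsimp
    fix a w assume a: "T a = 0" and w: "w \<in> W"
    have aB: "contr r a b = 0" if "b \<in> B" for b
    proof -
      have "b \<in> invsys r (Suc 0)" using that B(2) W by auto
      then have "contr r a b \<in> invsys r 0" by (rule contr_invsys)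
      moreover have "contr r a b 0 = 0" using fun_cong[OF a, of b] that by (simp add: T_def)
      ultimately show ?thesis by (auto simp: fun_eq_iff invsys_def mons_0) metis
    qed
    show "contr r a w = 0"
      using fsp.linear_eq_0_on_span[OF linear_contr aB] w B(3) by blast
  qed
  then have "fs.dim {a \<in> dirs r. T a = 0} \<le> fs.dim {a \<in> dirs r. \<forall>w\<in>W. contr r a w = 0}"
    by (rule dim_mono_fin_dim[rotated]) (rule fin_dim_subset[OF dirs_fin_dim], auto)
  ultimately show ?thesis by linarith
qed

text \<open>The pairing with \<open>F\<close> makes multiplication by \<open>x\<close> from degree 1 to 2 and from degree 2 to 3
  transposes of each other; only one inequality between their ranks is needed.\<close>

lemma rank_transpose_le:
  fixes F :: "mon \<Rightarrow> 'k::field"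
  assumes F: "F \<in> invsys r 4" and dimV: "fs.dim (range (\<lambda>a. contr r a F)) = r"
    and E: "E \<subseteq> invsys r 2" "\<And>a b. contr r a (contr r b F) \<in> E"
  shows "r \<le> fs.dim (contr r x ` E) + fs.dim {v \<in> range (\<lambda>a. contr r a F). contr r x v = 0}"
proof -
  let ?c = "\<lambda>a. contr r a F"
  \<comment> \<open>The directions that annihilate the image of \<open>x\<close> on
    \<open>E\<close>. They will embed into the kernel of \<open>x\<close> on the first
    derivatives.\<close>
  define X where "X = {a \<in> dirs r. \<forall>w\<in>contr r x ` E. contr r a w = 0}"
  have E2: "E \<subseteq> invsys r (Suc 1)" using E(1) by (simp add: numeral_2_eq_2)
  have rX: "r \<le> fs.dim (contr r x ` E) + fs.dim X"
    unfolding X_def by (rule dim_add_annihilator_ge[OF contr_image_invsys[OF E2]])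
  have X: "fs.subspace X"
    using dirs_subspace[of r] unfolding X_def fs.subspace_def
    by (auto simp: fsp.linear_add[OF linear_contr_dir] fsp.linear_scale[OF linear_contr_dir]
        fsp.linear_0[OF linear_contr_dir])
  have fdX: "fin_dim X" by (rule fin_dim_subset[OF dirs_fin_dim[of r]]) (auto simp: X_def)
  have "fs.dim {a \<in> dirs r. ?c a = 0} = 0"
    using rank_nullity[OF linear_contr_dir dirs_subspace dirs_fin_dim, of r r F] dimV
      dirs_dim[of r, where 'k = 'k] by (simp add: range_contr_dirs)
  then have "{a \<in> dirs r. ?c a = 0} \<subseteq> {0}"
    by (intro dim_eq_0_fin_dim fin_dim_subset[OF dirs_fin_dim[of r]]) auto
  then have "{a \<in> X. ?c a = 0} \<subseteq> {0}" by (auto simp: X_def)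
  then have "fs.dim {a \<in> X. ?c a = 0} \<le> card ({} :: (nat \<Rightarrow> 'k) set)"
    by (intro fs.dim_le_card) auto
  then have dX: "fs.dim X = fs.dim (?c ` X)"
    using rank_nullity[OF linear_contr_dir X fdX, of r F] by simp
  have F4: "F \<in> invsys r (Suc (Suc (Suc (Suc 0))))" using F by (simp add: eval_nat_numeral)
  \<comment> \<open>A quadric vanishes if all its second contractions do. By commutativity those of
    \<open>x a F\<close> are \<open>a\<close> applied to \<open>x\<close> times a second derivative
    of \<open>F\<close>, and that product lies in the image annihilated by \<open>a\<close>.\<close>
  have "?c ` X \<subseteq> {v \<in> range ?c. contr r x v = 0}"
  proof clarsimp
    fix a assume a: "a \<in> X"
    show "contr r x (contr r a F) = 0"
    proof (rule invsys_eq_0I[OF contr_invsys[OF contr_invsys[OF F4]]],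
        rule invsys_eq_0I[OF contr_invsys[OF contr_invsys[OF contr_invsys[OF F4]]]])
      fix i j
      have "contr r (unit_dir j) (contr r (unit_dir i) (contr r x (contr r a F))) =
          contr r a (contr r x (contr r (unit_dir j) (contr r (unit_dir i) F)))"
        by (simp only: contr_commute[of r "unit_dir j" a] contr_commute[of r "unit_dir i" a]
            contr_commute[of r x a] contr_commute[of r "unit_dir j" x] contr_commute[of r "unit_dir i" x])
      also have "\<dots> = 0" using a E(2) by (auto simp: X_def)
      finally show "contr r (unit_dir j) (contr r (unit_dir i) (contr r x (contr r a F))) = 0" .
    qed
  qed
  moreover have "fin_dim {v \<in> range ?c. contr r x v = 0}"
    using contr_invsys[OF F4] by (intro fin_dim_le_invsys[of _ r "Suc (Suc (Suc 0))"]) auto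
  ultimately have "fs.dim (?c ` X) \<le> fs.dim {v \<in> range ?c. contr r x v = 0}"
    by (intro dim_mono_fin_dim)
  then show ?thesis using rX dX by simp
qed

text \<open>Restricting once more, to the kernels \<open>Gy\<close> and \<open>Ky\<close> of a form
  \<open>y\<close> of maximal rank on \<open>K\<close>, makes the bound for cubics applicable: the
  excess of \<open>G\<close> over \<open>K\<close> survives in \<open>Gy\<close>, whose derivatives
  lie in \<open>Ky\<close>.\<close>

lemma corank_lower_bound:
  fixes F :: "mon \<Rightarrow> 'k::field_char_0"
  assumes F: "F \<in> invsys r 4" and dimV: "fs.dim (range (\<lambda>a. contr r a F)) = r"
    and E: "fs.subspace E" "E \<subseteq> invsys r 2" "\<And>a b. contr r a (contr r b F) \<in> E"
    and less: "fs.dim E + tet k < r"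
  shows "tri k + k + 4 + tet k + fs.dim (contr r x ` range (\<lambda>a. contr r a F)) \<le> r"
proof -
  let ?V = "range (\<lambda>a. contr r a F)"
  have F4: "F \<in> invsys r (Suc (Suc (Suc (Suc 0))))" using F by (simp add: eval_nat_numeral)
  have V: "fs.subspace ?V" "?V \<subseteq> invsys r 3"
    using fsp.linear_subspace_image[OF linear_contr_dir fs.subspace_UNIV] contr_invsys[OF F4]
    by (auto simp: numeral_3_eq_3)
  define G where "G = {v \<in> ?V. contr r x v = 0}"
  define K where "K = {q \<in> E. contr r x q = 0}"
  have G: "fs.subspace G" "G \<subseteq> invsys r 3"
    unfolding G_def using subspace_kernel_contr[OF V(1)] V(2) by auto
  have K: "fs.subspace K" "K \<subseteq> invsys r 2"
    unfolding K_def using subspace_kernel_contr[OF E(1)] E(2) by auto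
  have dV: "r = fs.dim (contr r x ` ?V) + fs.dim G"
    using contr_rank_nullity[OF V(1) fin_dim_le_invsys[OF V(2)], of r x] dimV by (simp add: G_def)
  have dE: "fs.dim E = fs.dim (contr r x ` E) + fs.dim K"
    unfolding K_def by (rule contr_rank_nullity[OF E(1) fin_dim_le_invsys[OF E(2)]])
  have dG: "fs.dim K + (r - fs.dim E) \<le> fs.dim G"
    using rank_transpose_le[OF F dimV E(2,3), of x] dE less unfolding G_def[symmetric] by linarith
  have GK: "contr r y v \<in> K" if "v \<in> G" for v y
    using that E(3) by (auto simp: G_def K_def contr_commute[of r x y])
  obtain y where y: "\<And>z. fs.dim (contr r z ` K) \<le> fs.dim (contr r y ` K)"
    using ex_max_rank[OF K(2)] by blast
  define \<rho> where "\<rho> = fs.dim (contr r y ` K)"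
  have \<rho>: "fs.dim K \<le> tri \<rho>" unfolding \<rho>_def by (rule green_quadrics[OF K y])
  define Gy where "Gy = {v \<in> G. contr r y v = 0}"
  define Ky where "Ky = {q \<in> K. contr r y q = 0}"
  have Gy: "fs.subspace Gy" "Gy \<subseteq> invsys r 3"
    unfolding Gy_def using subspace_kernel_contr[OF G(1)] G(2) by auto
  have Ky: "Ky \<subseteq> invsys r 2" using K(2) by (auto simp: Ky_def)
  have dK: "fs.dim K = \<rho> + fs.dim Ky"
    unfolding \<rho>_def Ky_def by (rule contr_rank_nullity[OF K(1) fin_dim_le_invsys[OF K(2)]])
  have "fs.dim G = fs.dim (contr r y ` G) + fs.dim Gy"
    unfolding Gy_def by (rule contr_rank_nullity[OF G(1) fin_dim_le_invsys[OF G(2)]])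
  moreover have "fs.dim (contr r y ` G) \<le> fs.dim K"
    using GK by (intro dim_mono_fin_dim[OF fin_dim_le_invsys[OF K(2)]]) auto
  \<comment> \<open>The image of \<open>G\<close> under \<open>y\<close> lies in \<open>K\<close>,
    so \<open>Gy\<close> has dimension at least \<open>dim G - dim K\<close>, hence at least
    \<open>r - dim E\<close>.\<close>
  ultimately have dGy: "tet k < fs.dim Gy" using dG less by linarith
  have "tri k < fs.dim Ky"
  proof (rule ccontr)
    assume "\<not> ?thesis"
    moreover have "contr r z ` Gy \<subseteq> Ky" for z
      using GK by (auto simp: Gy_def Ky_def contr_commute[of r y z])
    then have "fs.dim (contr r z ` Gy) \<le> fs.dim Ky" for z
      by (intro dim_mono_fin_dim[OF fin_dim_le_invsys[OF Ky]])
    ultimately have "fs.dim (contr r z ` Gy) \<le> tri k" for z by (meson not_le order_trans)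
    from dim_cubics_le_tet[OF Gy this] dGy show False by simp
  qed
  then have Kk: "tri k + \<rho> < fs.dim K" using dK by simp
  \<comment> \<open>Bootstrapping: \<open>k < \<rho>\<close> improves
    \<open>tri k + \<rho> < dim K\<close> to \<open>tri (Suc k) < dim K\<close>, which in turn gives
    \<open>\<rho> \<ge> k + 2\<close>.\<close>
  then have "k < \<rho>" using less_if_tri_less[OF _ \<rho>] by simp
  then have "Suc k < \<rho>" using less_if_tri_less[OF _ \<rho>, of "Suc k"] Kk by simp
  then have "tri k + k + 3 \<le> fs.dim K" using Kk by simp
  then show ?thesis using dG dV less by linarith
qed

text \<open>If the bound failed, \<open>corank_lower_bound\<close> with \<open>k = 2\<close> would
  give corank at least 3 + 2 + 4 + 4 = 13 for every linear form, and with \<open>k = 3\<close> at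
  least 6 + 3 + 4 + 10 = 23.\<close>

theorem dim_second_derivatives_ge:
  fixes F :: "mon \<Rightarrow> 'k::field_char_0"
  assumes F: "F \<in> invsys r 4" and dimV: "fs.dim (range (\<lambda>a. contr r a F)) = r"
    and E: "fs.subspace E" "E \<subseteq> invsys r 2" "\<And>a b. contr r a (contr r b F) \<in> E"
  shows "r = 24 \<Longrightarrow> 20 \<le> fs.dim E" "r = 40 \<Longrightarrow> 30 \<le> fs.dim E"
proof -
  let ?V = "range (\<lambda>a. contr r a F)"
  have F4: "F \<in> invsys r (Suc (Suc (Suc (Suc 0))))" using F by (simp add: eval_nat_numeral)
  have V: "fs.subspace ?V" "?V \<subseteq> invsys r 3"
    using fsp.linear_subspace_image[OF linear_contr_dir fs.subspace_UNIV] contr_invsys[OF F4]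
    by (auto simp: numeral_3_eq_3)
  show "20 \<le> fs.dim E" if "r = 24"
  proof (rule ccontr)
    assume "\<not> ?thesis"
    then have "fs.dim E + tet 2 < r" using that by (simp add: numeral_2_eq_2)
    from corank_lower_bound[OF F dimV E this]
    have "fs.dim (contr r z ` ?V) \<le> 11" for z using that by (simp add: numeral_2_eq_2)
    from dim_cubics_rank_11[OF V this] dimV that show False by simp
  qed
  show "30 \<le> fs.dim E" if "r = 40"
  proof (rule ccontr)
    assume "\<not> ?thesis"
    then have "fs.dim E + tet 3 < r" using that by (simp add: numeral_3_eq_3)
    from corank_lower_bound[OF F dimV E this]
    have "fs.dim (contr r z ` ?V) \<le> 17" for z using that by (simp add: numeral_3_eq_3)
    from dim_cubics_rank_17[OF V this] dimV that show False by simp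
  qed
qed

section \<open>The action of the polynomial ring\<close>

definition act :: "'k::field mpoly \<Rightarrow> (mon \<Rightarrow> 'k) \<Rightarrow> mon \<Rightarrow> 'k" where
  "act p f = (\<lambda>m. \<Sum>n\<in>Poly_Mapping.keys p. Poly_Mapping.lookup p n * f (m + n))"

lemma act_eq_sum:
  assumes "finite S" "Poly_Mapping.keys p \<subseteq> S"
  shows "act p f m = (\<Sum>n\<in>S. Poly_Mapping.lookup p n * f (m + n))"
  unfolding act_def using assms by (intro sum.mono_neutral_left) (auto simp: in_keys_iff)

lemma act_zero [simp]: "act 0 f = 0"
  by (auto simp: act_def)

lemma act_zero_right [simp]: "act p 0 = 0"
  by (auto simp: act_def)

lemma act_add: "act (p + q) f = act p f + act q f"
proof
  fix m
  let ?S = "Poly_Mapping.keys p \<union> Poly_Mapping.keys q"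
  have "act (p + q) f m = (\<Sum>n\<in>?S. Poly_Mapping.lookup (p + q) n * f (m + n))"
    by (intro act_eq_sum keys_add) auto
  then show "act (p + q) f m = (act p f + act q f) m"
    using act_eq_sum[of ?S p f m] act_eq_sum[of ?S q f m]
    by (simp add: lookup_add algebra_simps sum.distrib)
qed

lemma act_sum: "act (\<Sum>i\<in>I. p i) f = (\<Sum>i\<in>I. act (p i) f)"
  by (induction I rule: infinite_finite_induct) (auto simp: act_add)

lemma act_single: "act (Poly_Mapping.single n c) f = (\<lambda>m. c * f (m + n))"
  by (cases "c = 0") (auto simp: act_def)

lemma poly_mapping_sum_single:
  "p = (\<Sum>n\<in>Poly_Mapping.keys p. Poly_Mapping.single n (Poly_Mapping.lookup p n))"
  by (rule poly_mapping_eqI)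
    (auto simp: lookup_sum lookup_single when_def in_keys_iff)

lemma act_mult: "act (p * q) f = act p (act q f)"
proof
  fix m
  let ?P = "Poly_Mapping.keys p" and ?Q = "Poly_Mapping.keys q"
  have "p * q = (\<Sum>k\<in>?P. \<Sum>n\<in>?Q. Poly_Mapping.single (k + n) (Poly_Mapping.lookup p k * Poly_Mapping.lookup q n))"
    by (subst poly_mapping_sum_single[of p], subst poly_mapping_sum_single[of q])
      (simp add: sum_product mult_single)
  then have "act (p * q) f m = (\<Sum>k\<in>?P. \<Sum>n\<in>?Q. Poly_Mapping.lookup p k * Poly_Mapping.lookup q n * f (m + (k + n)))"
    by (simp add: act_sum act_single sum_fun_apply)
  also have "\<dots> = act p (act q f) m"
    by (simp add: act_def sum_distrib_left mult.assoc add.assoc)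
  finally show "act (p * q) f m = act p (act q f) m" .
qed

lemma act_smult: "act (smult_mp c p) f = fscale c (act p f)"
  unfolding smult_mp_def act_mult act_single by (auto simp: fun_eq_iff)

lemma act_one [simp]: "act 1 f = f"
  by (auto simp: act_def)

lemma act_var: "j < r \<Longrightarrow> act (var j) f = contr r (unit_dir j) f"
  unfolding var_def act_single by (auto simp: contr_unit_dir fun_eq_iff)

lemma lookup_smult_mp: "Poly_Mapping.lookup (smult_mp c p) m = c * Poly_Mapping.lookup p m"
proof -
  have "smult_mp c p = Poly_Mapping.map ((*) c) p"
    unfolding smult_mp_def by (rule mult_map_scale_conv_mult[symmetric])
  then show ?thesis by (simp add: Poly_Mapping.map.rep_eq when_def)
qed

lemma smult_mp_simps:
  "smult_mp 1 p = p" "smult_mp c (smult_mp d p) = smult_mp (c * d) p"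
  "smult_mp c 0 = 0" "smult_mp 0 p = 0"
  by (auto simp: poly_mapping_eq_iff fun_eq_iff lookup_smult_mp)

lemma forms_iff: "p \<in> forms r d \<longleftrightarrow> Poly_Mapping.lookup p \<in> invsys r d"
  unfolding forms_def polyring_def invsys_def mons_def by (auto simp: in_keys_iff)

lemma forms_keys: "p \<in> forms r d \<Longrightarrow> Poly_Mapping.keys p \<subseteq> mons r d"
  by (auto simp: forms_iff invsys_def in_keys_iff)

lemma forms_single: "n \<in> mons r d \<Longrightarrow> Poly_Mapping.single n c \<in> forms r d"
  by (auto simp: forms_iff invsys_def lookup_single when_def)

lemma forms_0 [simp]: "0 \<in> forms r d"
  by (simp add: forms_iff invsys_def)

lemma forms_add: "p \<in> forms r d \<Longrightarrow> q \<in> forms r d \<Longrightarrow> p + q \<in> forms r d"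
  by (simp add: forms_iff invsys_def lookup_add)

lemma forms_smult: "p \<in> forms r d \<Longrightarrow> smult_mp c p \<in> forms r d"
  by (simp add: forms_iff invsys_def lookup_smult_mp)

lemma forms_polyring: "p \<in> forms r d \<Longrightarrow> p \<in> polyring r"
  by (simp add: forms_def)

lemma forms_mult:
  assumes "p \<in> forms r d" "q \<in> forms r e"
  shows "p * q \<in> forms r (d + e)"
proof -
  have "Poly_Mapping.keys (p * q) \<subseteq> mons r (d + e)"
    using keys_mult[of p q] forms_keys[OF assms(1)] forms_keys[OF assms(2)] add_mons by fastforce
  then show ?thesis by (auto simp: forms_iff invsys_def in_keys_iff)
qed

lemma forms_var: "j < r \<Longrightarrow> var j \<in> forms r (Suc 0)"
  unfolding var_def by (rule forms_single) simp

lemma lookup_Abs_invsys: "g \<in> invsys r d \<Longrightarrow> Poly_Mapping.lookup (Abs_poly_mapping g) = g"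
  by (rule lookup_Abs_poly_mapping) (rule finite_subset[OF _ finite_mons[of r d]], auto simp: invsys_def)

lemma act_forms_eq: "p \<in> forms r d \<Longrightarrow> act p f m = (\<Sum>n\<in>mons r d. Poly_Mapping.lookup p n * f (m + n))"
  by (rule act_eq_sum[OF finite_mons forms_keys])

lemma act_forms_1:
  assumes "p \<in> forms r (Suc 0)"
  shows "act p f = contr r (\<lambda>j. Poly_Mapping.lookup p (xvar j)) f"
proof
  fix m
  have "inj_on xvar {..<r}"
    by (auto simp: inj_on_def) (metis lookup_single_eq lookup_single_not_eq nat.simps(3))
  then show "act p f m = contr r (\<lambda>j. Poly_Mapping.lookup p (xvar j)) f m"
    unfolding act_forms_eq[OF assms] mons_1 by (simp add: sum.reindex contr_def)
qed

lemma contr_as_act: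
  obtains p where "p \<in> forms r (Suc 0)" "\<And>f. contr r a f = act p f"
proof -
  define g where "g = (\<lambda>m. if m \<in> mons r (Suc 0) then \<Sum>j<r. if m = xvar j then a j else 0 else 0)"
  have g: "g \<in> invsys r (Suc 0)" by (simp add: g_def invsys_def)
  let ?p = "Abs_poly_mapping g"
  have "?p \<in> forms r (Suc 0)" using g by (simp add: forms_iff lookup_Abs_invsys)
  moreover have "xvar j = xvar i \<longleftrightarrow> j = i" for i j
    by (metis lookup_single_eq lookup_single_not_eq nat.simps(3))
  then have "Poly_Mapping.lookup ?p (xvar j) = a j" if "j < r" for j
    using that unfolding lookup_Abs_invsys[OF g] by (simp add: g_def)
  then have "contr r a f = contr r (\<lambda>j. Poly_Mapping.lookup ?p (xvar j)) f" for f
    by (simp add: contr_def)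
  ultimately show thesis using that[of ?p] by (simp add: act_forms_1)
qed

section \<open>Dimensions modulo an ideal as dimensions of spaces of derivatives\<close>

definition indep_mod :: "'k::field mpoly set \<Rightarrow> 'k mpoly set \<Rightarrow> nat \<Rightarrow> bool" where
  "indep_mod V W n \<longleftrightarrow> (\<exists>f::nat \<Rightarrow> 'k mpoly. (\<forall>i<n. f i \<in> V) \<and>
      (\<forall>c::nat \<Rightarrow> 'k. (\<Sum>i<n. smult_mp (c i) (f i)) \<in> W \<longrightarrow> (\<forall>i<n. c i = 0)))"

lemma qdim_eq_Sup: "qdim V W = Sup {n. indep_mod V W n}"
  by (simp add: qdim_def indep_mod_def)

text \<open>Ensures that the supremum defining \<open>qdim\<close> is an attained maximum:
  independence modulo \<open>W\<close> implies plain independence because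
  \<open>0 \<in> W\<close>.\<close>

lemma indep_mod_bound:
  assumes "V \<subseteq> forms r d" "0 \<in> W" "indep_mod V W n"
  shows "n \<le> card (mons r d)"
proof -
  obtain f where f: "\<And>i. i < n \<Longrightarrow> f i \<in> V"
      "\<And>c. (\<Sum>i<n. smult_mp (c i) (f i)) \<in> W \<Longrightarrow> \<forall>i<n. c i = 0"
    using assms(3) unfolding indep_mod_def by blast
  have "indep_on {..<n} (\<lambda>i. Poly_Mapping.lookup (f i))"
    unfolding indep_on_def
  proof (intro allI impI)
    fix c assume "\<forall>j. (\<Sum>i<n. c i * Poly_Mapping.lookup (f i) j) = 0"
    then have "(\<Sum>i<n. smult_mp (c i) (f i)) = 0"
      by (intro poly_mapping_eqI) (simp add: lookup_sum lookup_smult_mp)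
    then show "\<forall>i\<in>{..<n}. c i = 0" using f(2)[of c] assms(2) by auto
  qed
  moreover have "(\<lambda>i. Poly_Mapping.lookup (f i)) ` {..<n} \<subseteq> invsys r d"
    using f(1) assms(1) forms_iff by fastforce
  ultimately have "card {..<n} \<le> fs.dim (invsys r d :: (mon \<Rightarrow> 'a) set)"
    by (intro indep_on_card_le_dim fin_dim_invsys) auto
  also have "\<dots> = card (mons r d)"
    unfolding invsys_def by (rule fin_dim_finite_support(2)[OF finite_mons])
  finally show ?thesis by simp
qed

lemma indep_mod_le_qdim:
  assumes "V \<subseteq> forms r d" "0 \<in> W" "indep_mod V W n"
  shows "n \<le> qdim V W"
  unfolding qdim_eq_Sup using indep_mod_bound[OF assms(1,2)] assms(3)
  by (intro cSup_upper bdd_aboveI[of _ "card (mons r d)"]) auto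

lemma indep_mod_qdim:
  assumes "V \<subseteq> forms r d" "0 \<in> W"
  shows "indep_mod V W (qdim V W)"
proof -
  let ?S = "{n. indep_mod V W n}"
  have "?S \<subseteq> {..card (mons r d)}" using indep_mod_bound[OF assms] by auto
  then have "finite ?S" by (rule finite_subset) simp
  moreover have "0 \<in> ?S" by (simp add: indep_mod_def)
  ultimately have "Sup ?S \<in> ?S" using Max_in[of ?S] by (auto simp: Sup_nat_def)
  then show ?thesis by (simp add: qdim_eq_Sup)
qed

lemma indep_mod_1_iff: "indep_mod V W (Suc 0) \<longleftrightarrow> (\<exists>p\<in>V. \<forall>c. smult_mp c p \<in> W \<longrightarrow> c = 0)"
  unfolding indep_mod_def
proof safe
  fix f :: "nat \<Rightarrow> 'a mpoly"
  assume f: "\<forall>i<Suc 0. f i \<in> V"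
    "\<forall>c::nat \<Rightarrow> 'a. (\<Sum>i<Suc 0. smult_mp (c i) (f i)) \<in> W \<longrightarrow> (\<forall>i<Suc 0. c i = 0)"
  show "\<exists>p\<in>V. \<forall>c. smult_mp c p \<in> W \<longrightarrow> c = 0"
  proof (intro bexI[of _ "f 0"] allI impI)
    fix c assume "smult_mp c (f 0) \<in> W"
    then show "c = 0" using f(2)[rule_format, of "\<lambda>_. c" 0] by simp
  qed (use f in simp)
next
  fix p assume "p \<in> V" "\<forall>c. smult_mp c p \<in> W \<longrightarrow> c = 0"
  then show "\<exists>f. (\<forall>i<Suc 0. f i \<in> V) \<and>
      (\<forall>c::nat \<Rightarrow> 'a. (\<Sum>i<Suc 0. smult_mp (c i) (f i)) \<in> W \<longrightarrow> (\<forall>i<Suc 0. c i = 0))"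
    by (intro exI[of _ "\<lambda>_. p"]) simp
qed

text \<open>First isomorphism theorem: on \<open>V\<close>, membership in \<open>W\<close> means
  lying in the kernel of \<open>T\<close>, so independence modulo \<open>W\<close> is independence
  of images.\<close>

lemma qdim_eq_dim:
  fixes V W :: "'k::field mpoly set"
  assumes T: "\<And>p q. T (p + q) = T p + T q" "\<And>c p. T (smult_mp c p) = fscale c (T p)"
    and V: "0 \<in> V" "\<And>p q. p \<in> V \<Longrightarrow> q \<in> V \<Longrightarrow> p + q \<in> V" "\<And>c p. p \<in> V \<Longrightarrow> smult_mp c p \<in> V"
    and W: "\<And>p. p \<in> V \<Longrightarrow> p \<in> W \<longleftrightarrow> T p = 0"
    and fd: "fin_dim (T ` V)"
  shows "qdim V W = fs.dim (T ` V)"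
proof -
  have T0: "T 0 = 0" using T(1)[of 0 0] by simp
  have Tsum: "T (\<Sum>i<n. smult_mp (c i) (f i)) = (\<Sum>i<n. fscale (c i) (T (f i)))" for c f and n :: nat
    by (induction n) (auto simp: T T0)
  have mem: "(\<Sum>i<n. smult_mp (c i) (f i)) \<in> W \<longleftrightarrow> (\<forall>j. (\<Sum>i<n. c i * T (f i) j) = 0)"
    if "\<forall>i<n. f i \<in> V" for c f and n :: nat
  proof -
    have "(\<Sum>i<n. smult_mp (c i) (f i)) \<in> V"
      using that by (induction n) (auto simp: V)
    then show ?thesis by (simp add: W Tsum fun_eq_iff sum_fun_apply)
  qed
  have iff: "indep_mod V W n \<longleftrightarrow> (\<exists>f. (\<forall>i<n. f i \<in> V) \<and> indep_on {..<n} (\<lambda>i. T (f i)))" for n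
    unfolding indep_mod_def indep_on_def by (auto simp: mem)
  have ub: "n \<le> fs.dim (T ` V)" if n: "indep_mod V W n" for n
  proof -
    obtain f where f: "\<forall>i<n. f i \<in> V" "indep_on {..<n} (\<lambda>i. T (f i))" using n iff by blast
    have "card {..<n} \<le> fs.dim (T ` V)"
      using f(1) by (intro indep_on_card_le_dim[OF _ f(2) _ fd]) auto
    then show ?thesis by simp
  qed
  have "indep_mod V W (fs.dim (T ` V))"
  proof -
    obtain B where B: "finite B" "B \<subseteq> T ` V" "fs.independent B" "card B = fs.dim (T ` V)"
      using fin_dim_basis[OF fd] by metis
    obtain h where h: "bij_betw h {..<fs.dim (T ` V)} B"
      using ex_bij_betw_nat_finite[OF B(1)] B(4) by (auto simp: lessThan_atLeast0)
    have "\<forall>b\<in>B. \<exists>p\<in>V. T p = b" using B(2) by auto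
    then obtain g where g: "\<And>b. b \<in> B \<Longrightarrow> g b \<in> V" "\<And>b. b \<in> B \<Longrightarrow> T (g b) = b" by metis
    have hB: "h i \<in> B" if "i < fs.dim (T ` V)" for i
      using h that by (auto simp: bij_betw_def)
    have "indep_on {..<fs.dim (T ` V)} (\<lambda>i. T (g (h i)))"
      unfolding indep_on_def
    proof (intro allI impI)
      fix c assume c: "\<forall>j. (\<Sum>i<fs.dim (T ` V). c i * T (g (h i)) j) = 0"
      let ?k = "inv_into {..<fs.dim (T ` V)} h"
      have inv: "?k (h i) = i" if "i < fs.dim (T ` V)" for i
        using h that by (simp add: bij_betw_def inv_into_f_f)
      have "(\<Sum>b\<in>B. c (?k b) * b j) = 0" for j
      proof -
        have "(\<Sum>b\<in>B. c (?k b) * b j) = (\<Sum>i<fs.dim (T ` V). c (?k (h i)) * h i j)"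
          by (rule sum.reindex_bij_betw[OF h, symmetric])
        also have "\<dots> = (\<Sum>i<fs.dim (T ` V). c i * T (g (h i)) j)"
          using inv g(2) hB by (intro sum.cong) auto
        finally show ?thesis using c by simp
      qed
      from indep_onD[OF independent_indep_on[OF B(1,3)] this]
      have "c (?k b) = 0" if "b \<in> B" for b using that .
      then show "\<forall>i\<in>{..<fs.dim (T ` V)}. c i = 0" using inv hB by fastforce
    qed
    then show ?thesis unfolding iff using g(1) hB by (intro exI[of _ "\<lambda>i. g (h i)"]) auto
  qed
  then show ?thesis
    unfolding qdim_eq_Sup using ub by (intro cSup_eq_maximum) auto
qed

lemma act_invsys:
  assumes p: "p \<in> forms r d" and f: "f \<in> invsys r e"
  shows "d \<le> e \<Longrightarrow> act p f \<in> invsys r (e - d)" and "e < d \<Longrightarrow> act p f = 0"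
proof -
  have *: "f (m + n) = 0" if "n \<in> mons r d" "m \<notin> mons r (e - d) \<or> e < d" for m n
  proof -
    have "m + n \<notin> mons r e" using that by (auto simp: mons_def mdeg_add keys_add_nat)
    then show ?thesis using f by (simp add: invsys_def)
  qed
  show "act p f \<in> invsys r (e - d)" if "d \<le> e"
    unfolding invsys_def using * by (auto simp: act_forms_eq[OF p] intro!: sum.neutral)
  show "act p f = 0" if "e < d"
    using * that by (auto simp: act_forms_eq[OF p] fun_eq_iff intro!: sum.neutral)
qed

lemma qdim_forms_eq_dim:
  assumes "\<phi> \<in> invsys r e" and "\<And>p. p \<in> forms r d \<Longrightarrow> p \<in> W \<longleftrightarrow> act p \<phi> = 0"
  shows "qdim (forms r d) W = fs.dim ((\<lambda>p. act p \<phi>) ` forms r d)"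
proof (rule qdim_eq_dim)
  have "(\<lambda>p. act p \<phi>) ` forms r d \<subseteq> invsys r (e - d)"
    using act_invsys[OF _ assms(1)] fs.subspace_0[OF subspace_invsys] by (cases "d \<le> e") force+
  then show "fin_dim ((\<lambda>p. act p \<phi>) ` forms r d)" by (rule fin_dim_le_invsys)
qed (use assms in \<open>auto simp: act_add act_smult forms_add forms_smult\<close>)

lemma image_act_forms_1:
  fixes \<phi> :: "mon \<Rightarrow> 'k::field"
  shows "(\<lambda>p. act p \<phi>) ` forms r (Suc 0) = range (\<lambda>a. contr r a \<phi>)"
proof
  show "(\<lambda>p. act p \<phi>) ` forms r (Suc 0) \<subseteq> range (\<lambda>a. contr r a \<phi>)"
    by (auto simp: act_forms_1)
  show "range (\<lambda>a. contr r a \<phi>) \<subseteq> (\<lambda>p. act p \<phi>) ` forms r (Suc 0)"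
  proof (rule image_subsetI)
    fix a :: "nat \<Rightarrow> 'k"
    obtain p where "p \<in> forms r (Suc 0)" "\<And>f. contr r a f = act p f" by (rule contr_as_act) blast
    then show "contr r a \<phi> \<in> (\<lambda>p. act p \<phi>) ` forms r (Suc 0)" by auto
  qed
qed

lemma subspace_image_act: "fs.subspace ((\<lambda>p. act p \<phi>) ` forms r d)"
  unfolding fs.subspace_def
  by (auto simp: image_iff act_add[symmetric] act_smult[symmetric])
    (metis forms_0 act_zero, metis forms_add, metis forms_smult)

lemma contr_contr_in_image_act: "contr r a (contr r b \<phi>) \<in> (\<lambda>p. act p \<phi>) ` forms r 2"
proof -
  obtain p where p: "p \<in> forms r (Suc 0)" "\<And>f. contr r a f = act p f" by (rule contr_as_act) blast
  obtain q where q: "q \<in> forms r (Suc 0)" "\<And>f. contr r b f = act q f" by (rule contr_as_act) blast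
  have "p * q \<in> forms r 2" using forms_mult[OF p(1) q(1)] by (simp add: numeral_2_eq_2)
  then show ?thesis using p(2) q(2) by (auto simp: act_mult[symmetric])
qed

section \<open>Macaulay duality in socle degree 4\<close>

lemma single_0_polyring: "Poly_Mapping.single 0 c \<in> polyring r"
  by (simp add: polyring_def)

lemma var_polyring: "j < r \<Longrightarrow> var j \<in> polyring r"
  using forms_polyring[OF forms_var] .

lemma ideal_smult: "is_ideal r I \<Longrightarrow> p \<in> I \<Longrightarrow> smult_mp c p \<in> I"
  unfolding is_ideal_def smult_mp_def using single_0_polyring by blast

lemma ideal_sum: "is_ideal r I \<Longrightarrow> (\<And>i. i \<in> A \<Longrightarrow> p i \<in> I) \<Longrightarrow> (\<Sum>i\<in>A. p i) \<in> I"
  by (induction A rule: infinite_finite_induct) (auto simp: is_ideal_def)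

lemma ideal_smult_cancel:
  assumes "is_ideal r I" "smult_mp c p \<in> I" "c \<noteq> 0"
  shows "p \<in> I"
  using ideal_smult[OF assms(1,2), of "1 / c"] assms(3) by (simp add: smult_mp_simps)

lemma qdim_eq_0_imp_subset:
  assumes I: "is_ideal r I" and V: "V \<subseteq> forms r d" "qdim V I = 0"
  shows "V \<subseteq> I"
proof
  fix p assume p: "p \<in> V"
  show "p \<in> I"
  proof (rule ccontr)
    assume "p \<notin> I"
    then have "indep_mod V I (Suc 0)"
      unfolding indep_mod_1_iff using p ideal_smult_cancel[OF I] by blast
    from indep_mod_le_qdim[OF V(1) _ this] I V(2) show False by (simp add: is_ideal_def)
  qed
qed

lemma subset_imp_qdim_eq_0:
  assumes I: "is_ideal r I" and V: "V \<subseteq> I"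
  shows "qdim V I = 0"
proof -
  have "n = 0" if n: "indep_mod V I n" for n
  proof (rule ccontr)
    assume "n \<noteq> 0"
    obtain f where f: "\<And>i. i < n \<Longrightarrow> f i \<in> V"
        "\<And>c. (\<Sum>i<n. smult_mp (c i) (f i)) \<in> I \<Longrightarrow> \<forall>i<n. c i = 0"
      using n unfolding indep_mod_def by blast
    have "(\<Sum>i<n. smult_mp ((\<lambda>_. 1) i) (f i)) \<in> I"
      using f(1) V by (intro ideal_sum[OF I] ideal_smult[OF I]) auto
    from f(2)[OF this] \<open>n \<noteq> 0\<close> show False by simp
  qed
  moreover have "indep_mod V I 0" by (simp add: indep_mod_def)
  ultimately have "{n. indep_mod V I n} = {0}" by auto
  then show ?thesis by (simp add: qdim_eq_Sup)
qed

text \<open>As degree 5 vanishes, all of degree 4 is socle and already exhausts the socle dimension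
  1.\<close>

lemma socle_deg_eq_0_below:
  fixes I :: "'k::field mpoly set"
  assumes AG: "std_graded_AG r I" and h4: "hilb r I 4 = 1" and h5: "hilb r I 5 = 0" and d: "d < 4"
  shows "socle_deg r I d = 0"
proof (rule ccontr)
  assume d0: "socle_deg r I d \<noteq> 0"
  have I: "is_ideal r I" using AG by (simp add: std_graded_AG_def homogeneous_ideal_def)
  have "forms r 5 \<subseteq> I" by (rule qdim_eq_0_imp_subset[OF I order_refl h5[unfolded hilb_def]])
  then have "{f \<in> forms r 4. \<forall>j<r. var j * f \<in> I} = forms r 4"
    using forms_mult[OF forms_var, of _ r _ 4] by auto
  then have s4: "socle_deg r I 4 = 1" using h4 by (simp add: socle_deg_def hilb_def)
  let ?D = "{d. socle_deg r I d \<noteq> 0}"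
  have s: "(\<Sum>d\<in>?D. socle_deg r I d) = 1" using AG by (simp add: std_graded_AG_def socle_dim_def)
  \<comment> \<open>A sum over an infinite set is 0 by convention, so the value 1 forces
    finiteness.\<close>
  then have "finite ?D" by (metis sum.infinite zero_neq_one)
  then have "(\<Sum>d\<in>{d, 4}. socle_deg r I d) \<le> (\<Sum>d\<in>?D. socle_deg r I d)"
    using d0 s4 by (intro sum_mono2) auto
  then show False using s s4 d d0 by simp
qed

text \<open>The dual generator is the functional cutting out \<open>I\<close> in degree 4. Vanishing
  of the socle below degree 4 carries the equivalence down to all smaller degrees.\<close>

lemma inverse_system_of_AG:
  fixes I :: "'k::field mpoly set"
  assumes AG: "std_graded_AG r I" and h4: "hilb r I 4 = 1" and h5: "hilb r I 5 = 0"
  obtains \<phi> where "\<phi> \<in> invsys r 4"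
    and "\<And>d p. d \<le> 4 \<Longrightarrow> p \<in> forms r d \<Longrightarrow> p \<in> I \<longleftrightarrow> act p \<phi> = 0"
proof -
  have I: "is_ideal r I" using AG by (simp add: std_graded_AG_def homogeneous_ideal_def)
  then have I0: "0 \<in> I" and Iadd: "\<And>p q. p \<in> I \<Longrightarrow> q \<in> I \<Longrightarrow> p + q \<in> I"
    and Ivar: "\<And>j p. j < r \<Longrightarrow> p \<in> I \<Longrightarrow> var j * p \<in> I"
    using var_polyring unfolding is_ideal_def by blast+
  have q4: "qdim (forms r 4) I = Suc 0" using h4 by (simp add: hilb_def)
  obtain f where f: "f \<in> forms r 4" "\<And>c. smult_mp c f \<in> I \<Longrightarrow> c = 0"
    using indep_mod_qdim[OF order_refl I0, of r 4] unfolding q4 indep_mod_1_iff by blast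
  \<comment> \<open>Degree 4 is a line modulo \<open>I\<close>, spanned by \<open>f\<close>:
    otherwise \<open>f\<close> and \<open>p\<close> would be two independent elements.\<close>
  have ex: "\<exists>c. p + smult_mp (- c) f \<in> I" if p: "p \<in> forms r 4" for p
  proof (rule ccontr)
    assume no: "\<not> ?thesis"
    have "indep_mod (forms r 4) I 2"
      unfolding indep_mod_def
    proof (intro exI[of _ "\<lambda>i. if i = 0 then f else p"] conjI allI impI)
      fix c :: "nat \<Rightarrow> 'k" and i :: nat
      assume "(\<Sum>i<2. smult_mp (c i) (if i = 0 then f else p)) \<in> I" and i: "i < 2"
      then have c: "smult_mp (c 0) f + smult_mp (c 1) p \<in> I" by (simp add: numeral_2_eq_2)
      have c1: "c 1 = 0"
      proof (rule ccontr)
        assume "c 1 \<noteq> 0"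
        then have "smult_mp (1 / c 1) (smult_mp (c 0) f + smult_mp (c 1) p) =
            p + smult_mp (- (- (c 0 / c 1))) f"
          by (intro poly_mapping_eqI) (simp add: lookup_smult_mp lookup_add field_simps)
        then show False using ideal_smult[OF I c, of "1 / c 1"] no by metis
      qed
      then have "c 0 = 0" using c by (intro f(2)) (simp add: smult_mp_simps)
      then show "c i = 0" using c1 i by (cases i) auto
    qed (use f p in auto)
    from indep_mod_le_qdim[OF order_refl I0 this] q4 show False by simp
  qed
  then obtain \<gamma> where \<gamma>: "\<And>p. p \<in> forms r 4 \<Longrightarrow> p + smult_mp (- \<gamma> p) f \<in> I" by metis
  \<comment> \<open>The coordinate along \<open>f\<close> modulo \<open>I\<close>, tabulated on the
    quartic monomials.\<close>
  define \<phi> where "\<phi> = (\<lambda>m. if m \<in> mons r 4 then \<gamma> (Poly_Mapping.single m 1) else 0)"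
  have \<phi>: "\<phi> \<in> invsys r 4" by (simp add: \<phi>_def invsys_def)
  have base: "p \<in> I \<longleftrightarrow> act p \<phi> = 0" if p: "p \<in> forms r 4" for p
  proof -
    have "(\<Sum>n\<in>mons r 4. smult_mp (Poly_Mapping.lookup p n)
        (Poly_Mapping.single n 1 + smult_mp (- \<phi> n) f)) \<in> I"
      using \<gamma>[OF forms_single] by (intro ideal_sum[OF I] ideal_smult[OF I]) (simp add: \<phi>_def)
    also have "(\<Sum>n\<in>mons r 4. smult_mp (Poly_Mapping.lookup p n)
        (Poly_Mapping.single n 1 + smult_mp (- \<phi> n) f)) = p + smult_mp (- act p \<phi> 0) f"
    proof (rule poly_mapping_eqI)
      fix m
      have "(\<Sum>n\<in>mons r 4. Poly_Mapping.lookup p n * (1 when n = m)) = Poly_Mapping.lookup p m"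
        using p finite_mons[of r 4] by (auto simp: forms_iff invsys_def when_def if_distrib cong: if_cong)
      then show "Poly_Mapping.lookup (\<Sum>n\<in>mons r 4. smult_mp (Poly_Mapping.lookup p n)
          (Poly_Mapping.single n 1 + smult_mp (- \<phi> n) f)) m =
          Poly_Mapping.lookup (p + smult_mp (- act p \<phi> 0) f) m"
        by (simp add: lookup_sum lookup_smult_mp lookup_add lookup_single act_forms_eq[OF p]
            ring_distribs sum_subtractf sum_distrib_right mult.assoc)
    qed
    finally have *: "p + smult_mp (- act p \<phi> 0) f \<in> I" .
    have "p \<in> I \<longleftrightarrow> act p \<phi> 0 = 0"
    proof
      assume "p \<in> I"
      then have "(p + smult_mp (- act p \<phi> 0) f) + smult_mp (- 1) p \<in> I"
        using * ideal_smult[OF I] Iadd by blast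
      moreover have "(p + smult_mp (- act p \<phi> 0) f) + smult_mp (- 1) p = smult_mp (- act p \<phi> 0) f"
        by (intro poly_mapping_eqI) (simp add: lookup_smult_mp lookup_add)
      ultimately have "- act p \<phi> 0 = 0" by (intro f(2)) simp
      then show "act p \<phi> 0 = 0" by simp
    next
      assume "act p \<phi> 0 = 0"
      then show "p \<in> I" using * by (simp add: smult_mp_simps)
    qed
    moreover have "act p \<phi> \<in> invsys r 0" using act_invsys(1)[OF p \<phi>] by simp
    then have "act p \<phi> 0 = 0 \<longleftrightarrow> act p \<phi> = 0"
      by (auto simp: fun_eq_iff invsys_def mons_0) metis
    ultimately show ?thesis by simp
  qed
  \<comment> \<open>Induction on the distance \<open>e\<close> from degree 4. Both sides are
    detected by multiplying with all variables: the left one since there is no socle in degrees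
    below 4, the right one since \<open>act p \<phi>\<close> has positive degree.\<close>
  have desc: "\<forall>p\<in>forms r (4 - e). p \<in> I \<longleftrightarrow> act p \<phi> = 0" if "e \<le> 4" for e
    using that
  proof (induction e)
    case 0
    then show ?case using base by (simp del: zero_fun_apply)
  next
    case (Suc e)
    define d where "d = 4 - Suc e"
    have d: "Suc d = 4 - e" "4 - d = Suc e" "d < 4" "d \<le> 4" using Suc.prems by (auto simp: d_def)
    have "p \<in> I \<longleftrightarrow> act p \<phi> = 0" if p: "p \<in> forms r d" for p
    proof -
      have vp: "var j * p \<in> forms r (4 - e)" if "j < r" for j
        using forms_mult[OF forms_var[OF that] p] d(1) by simp
      have act_vp: "act (var j * p) \<phi> = contr r (unit_dir j) (act p \<phi>)" if "j < r" for j
        by (simp add: act_mult act_var[OF that])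
      have inv: "act p \<phi> \<in> invsys r (Suc e)" using act_invsys(1)[OF p \<phi> d(4)] d(2) by simp
      show ?thesis
      proof
        assume "p \<in> I"
        show "act p \<phi> = 0"
        proof (rule invsys_eq_0I[OF inv])
          fix j assume j: "j < r"
          have "act (var j * p) \<phi> = 0" using Suc Ivar[OF j \<open>p \<in> I\<close>] vp[OF j] by (simp del: zero_fun_apply)
          then show "contr r (unit_dir j) (act p \<phi>) = 0" using act_vp[OF j] by simp
        qed
      next
        assume "act p \<phi> = 0"
        then have "var j * p \<in> I" if "j < r" for j
          using Suc vp[OF that] act_vp[OF that] by (simp del: zero_fun_apply)
        then have "p \<in> {f \<in> forms r d. \<forall>j<r. var j * f \<in> I}" using p by simp
        moreover have "{f \<in> forms r d. \<forall>j<r. var j * f \<in> I} \<subseteq> I"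
          by (rule qdim_eq_0_imp_subset[OF I _ socle_deg_eq_0_below[OF AG h4 h5 d(3), unfolded socle_deg_def]])
            auto
        ultimately show "p \<in> I" by (rule rev_subsetD)
      qed
    qed
    then show ?case by (simp add: d_def del: zero_fun_apply)
  qed
  show thesis
  proof (rule that[OF \<phi>])
    fix d and p :: "'k mpoly" assume "d \<le> 4" "p \<in> forms r d"
    then show "p \<in> I \<longleftrightarrow> act p \<phi> = 0" using desc[of "4 - d"] by simp
  qed
qed

theorem AG_hf_lower_bound:
  assumes "is_AG_hf_1rhr1 TYPE('k::field_char_0) r h"
  shows "r = 24 \<Longrightarrow> 20 \<le> h" "r = 40 \<Longrightarrow> 30 \<le> h"
proof -
  obtain I :: "'k mpoly set" where I: "std_graded_AG r I" "hilb r I 1 = r" "hilb r I 2 = h"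
      "hilb r I 4 = 1" "hilb r I 5 = 0"
    using assms unfolding is_AG_hf_1rhr1_def by auto
  obtain \<phi> where \<phi>: "\<phi> \<in> invsys r 4"
      "\<And>d p. d \<le> 4 \<Longrightarrow> p \<in> forms r d \<Longrightarrow> p \<in> I \<longleftrightarrow> act p \<phi> = 0"
    by (rule inverse_system_of_AG[OF I(1,4,5)]) blast
  let ?E = "(\<lambda>p. act p \<phi>) ` forms r 2"
  have "qdim (forms r 1) I = fs.dim ((\<lambda>p. act p \<phi>) ` forms r 1)"
    by (rule qdim_forms_eq_dim[OF \<phi>(1) \<phi>(2)]) auto
  then have V: "fs.dim (range (\<lambda>a. contr r a \<phi>)) = r"
    using I(2) image_act_forms_1[of \<phi> r] by (simp add: hilb_def)
  have "qdim (forms r 2) I = fs.dim ?E"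
    by (rule qdim_forms_eq_dim[OF \<phi>(1) \<phi>(2)]) auto
  then have E: "fs.dim ?E = h" using I(3) by (simp add: hilb_def)
  have "?E \<subseteq> invsys r 2" using act_invsys(1)[OF _ \<phi>(1), of _ 2] by auto
  note b = dim_second_derivatives_ge[OF \<phi>(1) V subspace_image_act this contr_contr_in_image_act]
  show "r = 24 \<Longrightarrow> 20 \<le> h" "r = 40 \<Longrightarrow> 30 \<le> h" using b E by auto
qed

section \<open>The Gorenstein algebra of a quartic\<close>

lemma card_mons_1: "card (mons r (Suc 0)) = r"
proof -
  have "inj_on xvar {..<r}"
    by (auto simp: inj_on_def) (metis lookup_single_eq lookup_single_not_eq nat.simps(3))
  then show ?thesis by (simp add: mons_1 card_image)
qed

lemma dim_invsys: "fs.dim (invsys r d :: (mon \<Rightarrow> 'k::field) set) = card (mons r d)"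
  unfolding invsys_def by (rule fin_dim_finite_support(2)[OF finite_mons])

definition ann :: "nat \<Rightarrow> (mon \<Rightarrow> 'k::field) \<Rightarrow> 'k mpoly set" where
  "ann r \<phi> = {p \<in> polyring r. act p \<phi> = 0}"

lemma is_ideal_ann: "is_ideal r (ann r \<phi>)"
proof -
  have "q * p \<in> polyring r" if "p \<in> polyring r" "q \<in> polyring r" for p q :: "'a mpoly"
    using that keys_mult[of q p] by (fastforce simp: polyring_def keys_add_nat)
  moreover have "p + q \<in> polyring r" if "p \<in> polyring r" "q \<in> polyring r" for p q :: "'a mpoly"
    using that keys_add[of p q] by (fastforce simp: polyring_def)
  ultimately show ?thesis
    by (auto simp: is_ideal_def ann_def act_add act_mult) (simp add: polyring_def)
qed

lemma lookup_hcomp: "Poly_Mapping.lookup (hcomp d p) m = (if mdeg m = d then Poly_Mapping.lookup p m else 0)"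
proof -
  have "finite {m. (if mdeg m = d then Poly_Mapping.lookup p m else 0) \<noteq> 0}"
    by (rule finite_subset[OF _ finite_keys[of p]]) (auto simp: in_keys_iff split: if_splits)
  then show ?thesis by (simp add: hcomp_def)
qed

text \<open>At a monomial \<open>m\<close> only the terms of \<open>p\<close> of degree
  \<open>e - mdeg m\<close> contribute to \<open>act p \<phi>\<close>, so the homogeneous components
  annihilate \<open>\<phi>\<close> separately.\<close>

lemma homogeneous_ann:
  assumes \<phi>: "\<phi> \<in> invsys r e"
  shows "homogeneous_ideal r (ann r \<phi>)"
proof -
  have "hcomp d p \<in> ann r \<phi>" if p: "p \<in> ann r \<phi>" for d p
  proof -
    have keys: "Poly_Mapping.keys (hcomp d p) \<subseteq> Poly_Mapping.keys p"
      by (auto simp: in_keys_iff lookup_hcomp split: if_splits)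
    have "act (hcomp d p) \<phi> m = 0" for m
    proof (cases "mdeg m + d = e")
      case True
      have z: "\<phi> (m + n) = 0" if "mdeg n \<noteq> d" for n
        using that True \<phi> by (auto simp: invsys_def mons_def mdeg_add)
      have "act (hcomp d p) \<phi> m = (\<Sum>n\<in>Poly_Mapping.keys p. Poly_Mapping.lookup (hcomp d p) n * \<phi> (m + n))"
        by (rule act_eq_sum[OF finite_keys keys])
      also have "\<dots> = act p \<phi> m"
        unfolding act_def by (rule sum.cong) (auto simp: lookup_hcomp z)
      finally show ?thesis using p by (simp add: ann_def)
    next
      case False
      then have "\<phi> (m + n) = 0" if "mdeg n = d" for n
        using that \<phi> by (auto simp: invsys_def mons_def mdeg_add)
      then show ?thesis
        unfolding act_def by (intro sum.neutral) (auto simp: lookup_hcomp)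
    qed
    then show ?thesis using p keys by (auto simp: ann_def polyring_def fun_eq_iff)
  qed
  then show ?thesis using is_ideal_ann by (simp add: homogeneous_ideal_def)
qed

lemma ann_forms_iff: "p \<in> forms r d \<Longrightarrow> p \<in> ann r \<phi> \<longleftrightarrow> act p \<phi> = 0"
  by (simp add: ann_def forms_polyring)

text \<open>The converse direction of the duality. Injectivity says that \<open>\<phi>\<close>
  depends on all \<open>r\<close> variables; it gives the value \<open>r\<close> in degree 1 and, by
  the pairing with degree 3, in degree 3 as well.\<close>

theorem AG_hf_of_form:
  fixes \<phi> :: "mon \<Rightarrow> 'k::field"
  assumes \<phi>: "\<phi> \<in> invsys r 4" and r: "0 < r"
    and inj: "\<And>a. a \<in> dirs r \<Longrightarrow> contr r a \<phi> = 0 \<Longrightarrow> a = 0"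
  shows "is_AG_hf_1rhr1 TYPE('k) r (fs.dim ((\<lambda>p. act p \<phi>) ` forms r 2))"
proof -
  let ?I = "ann r \<phi>"
  have I: "is_ideal r ?I" by (rule is_ideal_ann)
  have hilb: "hilb r ?I d = fs.dim ((\<lambda>p. act p \<phi>) ` forms r d)" for d
    unfolding hilb_def by (rule qdim_forms_eq_dim[OF \<phi> ann_forms_iff])
  have "\<phi> \<noteq> 0"
  proof
    assume "\<phi> = 0"
    moreover have "unit_dir 0 \<in> dirs r" using r by (auto simp: unit_dir_def dirs_def)
    ultimately have "unit_dir 0 = (0 :: nat \<Rightarrow> 'k)" using inj by simp
    then have "unit_dir 0 0 = (0 :: 'k)" by simp
    then show False by (simp add: unit_dir_def)
  qed
  have big: "forms r d \<subseteq> ?I" if "5 \<le> d" for d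
    using act_invsys(2)[OF _ \<phi>, of _ d] that by (auto simp: ann_forms_iff)
  have "hilb r ?I 0 = 1"
    unfolding hilb
  proof (rule fs.dim_unique[of "{\<phi>}"])
    show "{\<phi>} \<subseteq> (\<lambda>p. act p \<phi>) ` forms r 0"
      using forms_single[of 0 r 0 1] by (force simp: mons_0 act_single image_iff)
    show "(\<lambda>p. act p \<phi>) ` forms r 0 \<subseteq> fs.span {\<phi>}"
    proof (rule image_subsetI)
      fix p :: "'k mpoly" assume "p \<in> forms r 0"
      then have "act p \<phi> = fscale (Poly_Mapping.lookup p 0) \<phi>"
        by (auto simp: fun_eq_iff act_forms_eq mons_0)
      then show "act p \<phi> \<in> fs.span {\<phi>}" by (simp only: fs.span_scale fs.span_base singletonI)
    qed
    show "fs.independent {\<phi>}" using \<open>\<phi> \<noteq> 0\<close> by simp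
  qed simp
  have "fs.dim {a \<in> dirs r. contr r a \<phi> = 0} \<le> card ({} :: (nat \<Rightarrow> 'k) set)"
    using inj by (intro fs.dim_le_card) auto
  then have "fs.dim (range (\<lambda>a. contr r a \<phi>)) = r"
    using rank_nullity[OF linear_contr_dir dirs_subspace dirs_fin_dim, of r r \<phi>]
      dirs_dim[of r, where 'k = 'k] by (simp add: range_contr_dirs)
  then have h1: "hilb r ?I 1 = r" unfolding hilb using image_act_forms_1[of \<phi> r] by simp
  let ?E = "(\<lambda>p. act p \<phi>) ` forms r 3"
  have E: "?E \<subseteq> invsys r 1" using act_invsys(1)[OF _ \<phi>, of _ 3] by auto
  have \<phi>4: "\<phi> \<in> invsys r (Suc 3)" using \<phi> by simp
  \<comment> \<open>A direction killing all third derivatives kills every coefficient of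
    \<open>contr r a \<phi>\<close>, because the coefficient at a cubic monomial is obtained by
    contracting with that monomial.\<close>
  have "a = 0" if a: "a \<in> dirs r" "\<forall>w\<in>?E. contr r a w = 0" for a
  proof (rule inj[OF a(1)], rule ext)
    fix m
    obtain q where q: "\<And>f. contr r a f = act q f" by (rule contr_as_act) blast
    show "contr r a \<phi> m = 0 m"
    proof (cases "m \<in> mons r 3")
      case True
      let ?p = "Poly_Mapping.single m (1 :: 'k)"
      have "contr r a \<phi> m = act ?p (contr r a \<phi>) 0" by (simp add: act_single)
      also have "act ?p (contr r a \<phi>) = contr r a (act ?p \<phi>)"
        by (simp add: q act_mult[symmetric] mult.commute)
      also have "\<dots> = 0" using a(2) forms_single[OF True] by blast
      finally show ?thesis by simp
    next
      case False
      then show ?thesis using contr_invsys[OF \<phi>4] by (auto simp: invsys_def)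
    qed
  qed
  then have "fs.dim {a \<in> dirs r. \<forall>w\<in>?E. contr r a w = 0} \<le> card ({} :: (nat \<Rightarrow> 'k) set)"
    by (intro fs.dim_le_card) auto
  then have "r \<le> fs.dim ?E" using dim_add_annihilator_ge[OF E] by simp
  moreover have "fs.dim ?E \<le> r"
    using dim_mono_fin_dim[OF fin_dim_invsys E] by (simp add: dim_invsys card_mons_1)
  ultimately have h3: "hilb r ?I 3 = r" unfolding hilb by simp
  have h4: "hilb r ?I 4 = 1"
  proof -
    let ?S = "(\<lambda>p. act p \<phi>) ` forms r 4"
    have S: "?S \<subseteq> invsys r 0" using act_invsys(1)[OF _ \<phi>, of _ 4] by auto
    obtain m where m: "\<phi> m \<noteq> 0" using \<open>\<phi> \<noteq> 0\<close> by (auto simp: fun_eq_iff)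
    then have "m \<in> mons r 4" using \<phi> by (auto simp: invsys_def)
    then have "act (Poly_Mapping.single m 1) \<phi> \<in> ?S" using forms_single by blast
    moreover have "act (Poly_Mapping.single m 1) \<phi> 0 \<noteq> 0" using m by (simp add: act_single)
    then have "act (Poly_Mapping.single m 1) \<phi> \<noteq> 0" by (metis zero_fun_apply)
    ultimately have "fs.dim ?S \<noteq> 0" using dim_eq_0_fin_dim[OF fin_dim_le_invsys[OF S]] by blast
    moreover have "fs.dim ?S \<le> 1"
      using dim_mono_fin_dim[OF fin_dim_invsys S] by (simp add: dim_invsys mons_0)
    ultimately show ?thesis unfolding hilb by simp
  qed
  have h5: "hilb r ?I d = 0" if "5 \<le> d" for d
    unfolding hilb_def by (rule subset_imp_qdim_eq_0[OF I big[OF that]])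
  \<comment> \<open>Below degree 4, a form in the socle has a derivative \<open>act p \<phi>\<close>
    of positive degree killed by all variables, so it lies in the ideal.\<close>
  have socle: "socle_deg r ?I d = (if d = 4 then 1 else 0)" for d
  proof (cases "d = 4")
    case True
    have "{f \<in> forms r 4. \<forall>j<r. var j * f \<in> ?I} = forms r 4"
      using forms_mult[OF forms_var, of _ r _ 4] big[of 5] by auto
    then show ?thesis using h4 True by (simp add: socle_deg_def hilb_def)
  next
    case False
    have "{f \<in> forms r d. \<forall>j<r. var j * f \<in> ?I} \<subseteq> ?I"
    proof (cases "5 \<le> d")
      case True
      then show ?thesis using big by auto
    next
      case d: False
      show ?thesis
      proof clarsimp
        fix p assume p: "p \<in> forms r d" "\<forall>j<r. var j * p \<in> ?I"
        have "act p \<phi> \<in> invsys r (Suc (3 - d))"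
          using act_invsys(1)[OF p(1) \<phi>] d False by (simp add: Suc_diff_le[symmetric])
        then have "act p \<phi> = 0"
        proof (rule invsys_eq_0I)
          fix j assume j: "j < r"
          then show "contr r (unit_dir j) (act p \<phi>) = 0"
            using p(2) unfolding act_var[OF j, symmetric] by (simp add: ann_def act_mult)
        qed
        then show "p \<in> ?I" using p(1) by (simp add: ann_forms_iff)
      qed
    qed
    then show ?thesis using False subset_imp_qdim_eq_0[OF I] by (simp add: socle_deg_def)
  qed
  have "p = 0" if p: "p \<in> forms r 1" "p \<in> ?I" for p
  proof (rule poly_mapping_eqI)
    fix m
    have p1: "p \<in> forms r (Suc 0)" using p(1) by simp
    define a where "a = (\<lambda>j. if j < r then Poly_Mapping.lookup p (xvar j) else 0)"
    have "contr r a \<phi> = act p \<phi>" by (simp add: act_forms_1[OF p1] contr_def a_def)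
    then have "contr r a \<phi> = 0" using p by (simp add: ann_def)
    then have a0: "a = 0" by (intro inj) (auto simp: dirs_def a_def)
    show "Poly_Mapping.lookup p m = Poly_Mapping.lookup 0 m"
    proof (cases "m \<in> mons r (Suc 0)")
      case True
      then obtain j where "j < r" "m = xvar j" by (auto simp: mons_1)
      then show ?thesis using fun_cong[OF a0, of j] by (simp add: a_def)
    next
      case False
      then show ?thesis using p1 by (simp add: forms_iff invsys_def)
    qed
  qed
  moreover have "0 \<in> ?I" using I by (simp add: is_ideal_def)
  ultimately have "?I \<inter> forms r 1 = {0}" by auto
  moreover have "1 \<notin> ?I" using \<open>\<phi> \<noteq> 0\<close> by (simp add: ann_def)
  moreover have "artinian r ?I" using big by (auto simp: artinian_def)
  moreover have "socle_dim r ?I = 1" by (simp add: socle_dim_def socle)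
  ultimately have "std_graded_AG r ?I"
    using homogeneous_ann[OF \<phi>] by (simp add: std_graded_AG_def)
  then show ?thesis
    unfolding is_AG_hf_1rhr1_def using \<open>hilb r ?I 0 = 1\<close> h1 h3 h4 h5 hilb[of 2] by blast
qed

section \<open>The trivial extension\<close>

text \<open>Splits by divisibility by the last variable; counting gives Pascal's rule.\<close>

lemma mons_Suc_Suc:
  "mons (Suc n) (Suc d) = mons n (Suc d) \<union> (\<lambda>m. m + xvar n) ` mons (Suc n) d"
proof (intro equalityI subsetI)
  fix m assume m: "m \<in> mons (Suc n) (Suc d)"
  show "m \<in> mons n (Suc d) \<union> (\<lambda>m. m + xvar n) ` mons (Suc n) d"
  proof (cases "n \<in> Poly_Mapping.keys m")
    case True
    then obtain k where k: "m = k + xvar n" by (rule mon_split_key)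
    with m have "k \<in> mons (Suc n) d" by (auto simp: mons_def mdeg_add keys_add_nat)
    then show ?thesis using k by blast
  next
    case False
    then show ?thesis using m by (auto simp: mons_def less_Suc_eq)
  qed
next
  fix m assume "m \<in> mons n (Suc d) \<union> (\<lambda>m. m + xvar n) ` mons (Suc n) d"
  then show "m \<in> mons (Suc n) (Suc d)"
    by (auto simp: mons_def mdeg_add keys_add_nat less_Suc_eq)
qed

lemma card_mons_Suc_Suc:
  "card (mons (Suc n) (Suc d)) = card (mons n (Suc d)) + card (mons (Suc n) d)"
proof -
  have "mons n (Suc d) \<inter> (\<lambda>m. m + xvar n) ` mons (Suc n) d = {}"
    by (auto simp: mons_def keys_add_nat)
  moreover have "inj_on (\<lambda>m. m + xvar n) (mons (Suc n) d)"
    by (auto simp: inj_on_def)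
  ultimately show ?thesis
    unfolding mons_Suc_Suc by (simp add: card_Un_disjoint finite_mons card_image)
qed

lemma mons_0_Suc: "mons 0 (Suc d) = {}"
  by (auto simp: mons_def)

lemma card_mons_2: "card (mons n 2) = tri n"
proof (induction n)
  case (Suc n)
  then show ?case using card_mons_Suc_Suc[of n 1] by (simp add: numeral_2_eq_2 card_mons_1)
qed (simp add: numeral_2_eq_2 mons_0_Suc)

lemma card_mons_3: "card (mons n 3) = tet n"
proof (induction n)
  case (Suc n)
  then show ?case using card_mons_Suc_Suc[of n 2] card_mons_2[of "Suc n"] by (simp add: numeral_3_eq_3)
qed (simp add: numeral_3_eq_3 mons_0_Suc)

text \<open>The form \<open>\<Sum> M y\<^sub>M\<close>, the sum running over the cubic monomials \<open>M\<close> in \<open>n\<close> variables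
  (Stanley's trivial extension); its second derivatives are spanned by the derivatives along the
  quadratic monomials in these variables and by these monomials themselves.\<close>

theorem AG_hf_trivial_extension:
  assumes n: "0 < n"
  obtains h where "is_AG_hf_1rhr1 TYPE('k::field) (n + tet n) h" "h \<le> 2 * tri n"
proof -
  define r where "r = n + tet n"
  \<comment> \<open>A numbering of the cubic monomials: the variable paired with \<open>M\<close>
    gets the index \<open>n + b M\<close>, beyond the first \<open>n\<close> variables.\<close>
  obtain b where b: "bij_betw b (mons n 3) {0..<tet n}"
    using ex_bij_betw_finite_nat[OF finite_mons, of n 3] card_mons_3 by auto
  define \<beta> where "\<beta> M = n + b M" for M
  have \<beta>_inj: "M = M'" if "M \<in> mons n 3" "M' \<in> mons n 3" "\<beta> M = \<beta> M'" for M M'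
    using b that by (auto simp: \<beta>_def bij_betw_def inj_on_def)
  have \<beta>_less: "\<beta> M < r" if "M \<in> mons n 3" for M
    using b that by (auto simp: \<beta>_def bij_betw_def r_def)
  have \<beta>_surj: "\<exists>M\<in>mons n 3. j = \<beta> M" if "n \<le> j" "j < r" for j
  proof -
    have "j - n \<in> b ` mons n 3" using b that by (auto simp: bij_betw_def r_def)
    then show ?thesis using that(1) by (force simp: \<beta>_def)
  qed
  have nr: "n \<le> r" by (simp add: r_def)
  have lookup0: "Poly_Mapping.lookup M j = 0" if "M \<in> mons n d" "n \<le> j" for M j d
    using that by (auto simp: mons_def in_keys_iff)
  define \<phi> where "\<phi> m = (if \<exists>M\<in>mons n 3. m = M + xvar (\<beta> M) then 1 else 0 :: 'k)" for m
  \<comment> \<open>A term of \<open>\<phi>\<close> contains exactly one of the added variables, and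
    that variable determines its cubic cofactor.\<close>
  have \<phi>_add: "\<phi> (u + xvar (\<beta> M)) = (if u = M then 1 else 0)" if M: "M \<in> mons n 3" for u M
  proof -
    have "u = M" if M': "M' \<in> mons n 3" and eq: "u + xvar (\<beta> M) = M' + xvar (\<beta> M')" for M'
    proof -
      have "Poly_Mapping.lookup (M' + xvar (\<beta> M')) (\<beta> M) \<noteq> 0"
        unfolding eq[symmetric] by (simp add: lookup_add)
      then have "\<beta> M' = \<beta> M"
        using lookup0[OF M', of "\<beta> M"] by (auto simp: lookup_add lookup_single \<beta>_def when_def split: if_splits)
      then have "M' = M" using \<beta>_inj M M' by blast
      then show ?thesis using eq by simp
    qed
    then show ?thesis using M by (auto simp: \<phi>_def)
  qed
  have \<phi>_no_y: "\<phi> m = 0" if "m \<in> mons n d" for m d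
  proof -
    have "m \<noteq> M + xvar (\<beta> M)" for M
      using lookup0[OF that, of "\<beta> M"] by (auto simp: lookup_add \<beta>_def)
    then show ?thesis by (auto simp: \<phi>_def)
  qed
  have \<phi>: "\<phi> \<in> invsys r 4"
  proof -
    have "M + xvar (\<beta> M) \<in> mons r 4" if M: "M \<in> mons n 3" for M
    proof -
      have "M \<in> mons r 3" using M nr by (auto simp: mons_def)
      then have "M + xvar (\<beta> M) \<in> mons r (3 + Suc 0)"
        by (intro add_mons) (auto simp: \<beta>_less M)
      then show ?thesis by simp
    qed
    then show ?thesis by (auto simp: invsys_def \<phi>_def)
  qed
  have inj: "a = 0" if a: "a \<in> dirs r" "contr r a \<phi> = 0" for a
  proof
    fix j
    have sum0: "(\<Sum>i<r. a i * \<phi> (m + xvar i)) = 0" for m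
      using fun_cong[OF a(2), of m] by (simp add: contr_def)
    consider "r \<le> j" | "j < n" | "n \<le> j" "j < r" by linarith
    then show "a j = 0 j"
    proof cases
      case 1
      then show ?thesis using a(1) by (simp add: dirs_def)
    next
      case 2
      \<comment> \<open>Reading the relation at the square of \<open>xvar j\<close> times the
        variable paired with its cube isolates \<open>a j\<close>: only direction \<open>j\<close>
        completes this to a term of \<open>\<phi>\<close>.\<close>
      let ?M = "xvar j + xvar j + xvar j"
      have M: "?M \<in> mons n 3" using 2 by (auto simp: mons_def mdeg_add keys_add_nat)
      have "\<phi> (xvar j + xvar j + xvar (\<beta> ?M) + xvar i) = (if i = j then 1 else 0)" for i
      proof -
        have "\<phi> (xvar j + xvar j + xvar (\<beta> ?M) + xvar i) = \<phi> ((xvar j + xvar j + xvar i) + xvar (\<beta> ?M))"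
          by (simp add: ac_simps)
        also have "\<dots> = (if xvar j + xvar j + xvar i = ?M then 1 else 0)" by (rule \<phi>_add[OF M])
        also have "xvar j + xvar j + xvar i = ?M \<longleftrightarrow> i = j"
          by (metis add_left_cancel lookup_single_eq lookup_single_not_eq nat.simps(3))
        finally show ?thesis .
      qed
      then have "(\<Sum>i<r. a i * (if i = j then 1 else 0)) = 0"
        using sum0[of "xvar j + xvar j + xvar (\<beta> ?M)"] by simp
      then show ?thesis using 2 nr by (simp add: if_distrib cong: if_cong)
    next
      case 3
      then obtain M where M: "M \<in> mons n 3" "j = \<beta> M" using \<beta>_surj by blast
      \<comment> \<open>Reading the relation at \<open>M\<close> itself isolates the direction
        paired with \<open>M\<close>; one of the first \<open>n\<close> variables would leave a
        monomial without any added variable.\<close>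
      have "\<phi> (M + xvar i) = (if i = j then 1 else 0)" if i: "i < r" for i
      proof (cases "i < n")
        case True
        then have "M + xvar i \<in> mons n (3 + Suc 0)" using M(1) by (intro add_mons) auto
        then show ?thesis using \<phi>_no_y True 3 by auto
      next
        case False
        then obtain M' where M': "M' \<in> mons n 3" "i = \<beta> M'" using \<beta>_surj i by (meson not_le)
        then show ?thesis using \<phi>_add[OF M'(1)] \<beta>_inj[OF M(1) M'(1)] M(2) by auto
      qed
      then have "(\<Sum>i<r. a i * \<phi> (M + xvar i)) = (\<Sum>i<r. a i * (if i = j then 1 else 0))"
        by (intro sum.cong) auto
      then show ?thesis using sum0[of M] 3 by (simp add: if_distrib cong: if_cong)
    qed
  qed
  let ?s = "\<lambda>q. act (Poly_Mapping.single q 1) \<phi>"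
  let ?u = "\<lambda>q m. if m = q then 1 else 0 :: 'k"
  let ?B = "?s ` mons n 2 \<union> ?u ` mons n 2"
  have s_y: "?s (xvar i + xvar (\<beta> M)) \<in> fs.span ?B" if M: "M \<in> mons n 3" for i M
  proof -
    \<comment> \<open>Contraction by the variable paired with \<open>M\<close> leaves the monomial
      \<open>M\<close>. A further variable yields the quotient if it divides \<open>M\<close>, and 0
      otherwise, in particular for a second added variable.\<close>
    have s: "?s (xvar i + xvar (\<beta> M)) = (\<lambda>m. if m + xvar i = M then 1 else 0)"
      using \<phi>_add[OF M] by (simp add: act_single add.assoc[symmetric])
    show ?thesis
    proof (cases "i \<in> Poly_Mapping.keys M")
      case True
      then obtain q where q: "M = q + xvar i" by (rule mon_split_key)
      then have "q \<in> mons n 2" using M by (auto simp: mons_def mdeg_add keys_add_nat)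
      then have "?u q \<in> fs.span ?B" by (intro fs.span_base) blast
      moreover have "?s (xvar i + xvar (\<beta> M)) = ?u q" unfolding s using q by auto
      ultimately show ?thesis by (simp only:)
    next
      case False
      then have "m + xvar i \<noteq> M" for m by (auto simp: keys_add_nat)
      then have "?s (xvar i + xvar (\<beta> M)) = 0" unfolding s by auto
      then show ?thesis by (simp only: fs.span_zero)
    qed
  qed
  have s_span: "?s q \<in> fs.span ?B" if "q \<in> mons r 2" for q
  proof -
    have "q \<in> mons r (Suc (Suc 0))" using that by (simp add: numeral_2_eq_2)
    then obtain i q' where "i < r" "q' \<in> mons r (Suc 0)" "q = q' + xvar i" by (rule mons_SucE)
    then obtain j where ij: "i < r" "j < r" "q = xvar j + xvar i" by (auto simp: mons_1)
    consider "i < n" "j < n" | "n \<le> i" | "n \<le> j" by linarith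
    then show ?thesis
    proof cases
      case 1
      then have "q \<in> mons n 2" using ij by (auto simp: mons_def mdeg_add keys_add_nat)
      then show ?thesis by (intro fs.span_base) blast
    next
      case 2
      then obtain M where "M \<in> mons n 3" "i = \<beta> M" using \<beta>_surj ij by blast
      then show ?thesis using s_y ij by blast
    next
      case 3
      then obtain M where M: "M \<in> mons n 3" "j = \<beta> M" using \<beta>_surj ij by blast
      then have "q = xvar i + xvar (\<beta> M)" using ij by (simp add: add.commute)
      then show ?thesis using s_y[OF M(1)] by blast
    qed
  qed
  have "(\<lambda>p. act p \<phi>) ` forms r 2 \<subseteq> fs.span ?B"
  proof (rule image_subsetI)
    fix p :: "'k mpoly" assume p: "p \<in> forms r 2"
    have "act p \<phi> = (\<Sum>q\<in>mons r 2. fscale (Poly_Mapping.lookup p q) (?s q))"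
      by (auto simp: fun_eq_iff act_forms_eq[OF p] sum_fun_apply act_single)
    also have "\<dots> \<in> fs.span ?B" by (intro fs.span_sum fs.span_scale s_span)
    finally show "act p \<phi> \<in> fs.span ?B" .
  qed
  then have "fs.dim ((\<lambda>p. act p \<phi>) ` forms r 2) \<le> card ?B"
    by (rule fs.dim_le_card) (simp add: finite_mons)
  also have "card ?B \<le> card (?s ` mons n 2) + card (?u ` mons n 2)" by (rule card_Un_le)
  also have "\<dots> \<le> card (mons n 2) + card (mons n 2)"
    by (intro add_mono card_image_le finite_mons)
  also have "\<dots> = 2 * tri n" by (simp add: card_mons_2)
  finally have "fs.dim ((\<lambda>p. act p \<phi>) ` forms r 2) \<le> 2 * tri n" .
  moreover have "is_AG_hf_1rhr1 TYPE('k) r (fs.dim ((\<lambda>p. act p \<phi>) ` forms r 2))"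
    using n nr by (intro AG_hf_of_form[OF \<phi> _ inj]) auto
  ultimately show thesis using that unfolding r_def by blast
qed

text \<open>The construction only bounds its \<open>h\<close> from above; the lower bound, applied
  to the same \<open>h\<close>, turns this into equality.\<close>

lemma mu_eqI:
  assumes "is_AG_hf_1rhr1 K r h" "h \<le> c" "\<And>h'. is_AG_hf_1rhr1 K r h' \<Longrightarrow> c \<le> h'"
  shows "mu K r = c"
proof -
  have "h = c" using assms(2) assms(3)[OF assms(1)] by simp
  then show ?thesis unfolding mu_def using assms(1,3) by (intro Least_equality) auto
qed

theorem theorem3p6:
  shows "delta TYPE('k::field_char_0) 24 = 4 \<and> delta TYPE('k::field_char_0) 40 = 10"
proof -
  obtain h where h: "is_AG_hf_1rhr1 TYPE('k) (4 + tet 4) h" "h \<le> 2 * tri 4"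
    by (rule AG_hf_trivial_extension[of 4]) auto
  \<comment> \<open>Hence \<open>4 + tet 4\<close> is 24, and \<open>2 * tri 4\<close> is 20,
    exactly the lower bound.\<close>
  have "tet 4 = 20" "tri 4 = 10" by (simp_all add: eval_nat_numeral)
  with h have "mu TYPE('k) 24 = 20"
    using AG_hf_lower_bound(1) by (intro mu_eqI[of _ _ h]) auto
  moreover obtain h' where h': "is_AG_hf_1rhr1 TYPE('k) (5 + tet 5) h'" "h' \<le> 2 * tri 5"
    by (rule AG_hf_trivial_extension[of 5]) auto
  have "tet 5 = 35" "tri 5 = 15" by (simp_all add: eval_nat_numeral)
  with h' have "mu TYPE('k) 40 = 30"
    using AG_hf_lower_bound(2) by (intro mu_eqI[of _ _ h']) auto
  ultimately show ?thesis by (simp add: delta_def)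
qed

end
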